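(* Let $k,p$ be fixed integers with $1\le p\le k$. Then, as $n\to\infty$, $$\gamma_{D_\infty}(k,p,n)=\frac{\binom{2p-2}{p-1}}{2^{2p-2}}\cdot\frac{2^{k-1}}{(k-1)!}\,n^{k-1}+O(n^{k-2})=\Pr\bigl(\text{a uniformly random subset of }\{1,\dots,2p-2\}\text{ has size }p-1\bigr)\cdot\frac{2^{k-1}}{(k-1)!}\,n^{k-1}+O(n^{k-2}),$$ where the implied constants depend only on $k$ and $p$. In particular, for all sufficiently large $n$ (depending on $k$), $\gamma_{D_\infty}(k,n)=\gamma_{D_\infty}(k,1,n)$, and as $n\to\infty$ $$\gamma_{D_\infty}(k,n)=\frac{2^{k-1}}{(k-1)!}\,n^{k-1}+O(n^{k-2}).$$
   Context: The infinite dihedral group is $D_\infty=\mathbb{Z}\rtimes\{\pm1\}$, with underlying set $\mathbb{Z}\times\{\pm1\}$ and product $(a_1,b_1)(a_2,b_2)=(a_1+b_1a_2,\,b_1b_2)$. An element $(a,b)$ is a translation if $b=1$ and a reflection if $b=-1$. For a subset $S$ of a group, $S^n=\{s_1\cdots s_n : s_1,\dots,s_n\in S\}$. For $0\le p\le k$, $$\gamma_{D_\infty}(k,p,n)=\max\{|S^n| : S\subset D_\infty \text{ consists of exactly } p \text{ reflections and } k-p \text{ translations}\},$$ and $\gamma_{D_\infty}(k,n)=\max\{|S^n| : S\subset D_\infty,\ |S|=k\}=\max_{0\le p\le k}\gamma_{D_\infty}(k,p,n)$. *)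

theory Defs
  imports
    "HOL-Algebra.Group"
    "HOL-Library.Landau_Symbols"
    "HOL-Probability.Probability_Mass_Function"
begin

definition D_inf :: "(int \<times> int) monoid" where
  "D_inf = \<lparr>carrier = UNIV \<times> {1, -1},
            monoid.mult = (\<lambda>(a1, b1) (a2, b2). (a1 + b1 * a2, b1 * b2)),
            one = (0, 1)\<rparr>"

lemma group_D_inf: "group D_inf"
proof (rule groupI)
  fix x assume "x \<in> carrier D_inf"
  then show "\<exists>y\<in>carrier D_inf. y \<otimes>\<^bsub>D_inf\<^esub> x = \<one>\<^bsub>D_inf\<^esub>"
    by (intro bexI[of _ "(- snd x * fst x, snd x)"]) (auto simp: D_inf_def)
qed (auto simp: D_inf_def algebra_simps)

definition dihedral_translations :: "(int \<times> int) set" where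
  "dihedral_translations = {x \<in> carrier D_inf. snd x = 1}"

definition dihedral_reflections :: "(int \<times> int) set" where
  "dihedral_reflections = {x \<in> carrier D_inf. snd x = -1}"

definition set_power :: "('a, 'b) monoid_scheme \<Rightarrow> 'a set \<Rightarrow> nat \<Rightarrow> 'a set" where
  "set_power G S n = {foldr (monoid.mult G) xs \<one>\<^bsub>G\<^esub> | xs. length xs = n \<and> set xs \<subseteq> S}"

text \<open>
  The explicit \<open>finite S\<close> matters when \<open>p = 0\<close> or \<open>p = k\<close>, since
  infinite sets have cardinality \<open>0\<close> in HOL. The definition is only meaningful for
  \<open>p \<le> k\<close>.
\<close>

definition gamma_refl :: "nat \<Rightarrow> nat \<Rightarrow> nat \<Rightarrow> nat" where
  "gamma_refl k p n = Max {card (set_power D_inf S n) | S.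
     S \<subseteq> carrier D_inf \<and> finite S \<and>
     card (S \<inter> dihedral_reflections) = p \<and> card (S \<inter> dihedral_translations) = k - p}"

definition gamma :: "nat \<Rightarrow> nat \<Rightarrow> nat" where
  "gamma k n = Max {card (set_power D_inf S n) | S.
     S \<subseteq> carrier D_inf \<and> finite S \<and> card S = k}"

text \<open>
  The maxima above are taken over finite nonempty sets, and the second one is the
  maximum of the first over \<open>p\<close>.
\<close>

lemma card_set_power_le:
  assumes "finite S"
  shows "card (set_power G S n) \<le> card S ^ n"
proof -
  have "set_power G S n = (\<lambda>xs. foldr (monoid.mult G) xs \<one>\<^bsub>G\<^esub>) ` {xs. set xs \<subseteq> S \<and> length xs = n}"
    by (auto simp: set_power_def)
  then show ?thesis
    using card_image_le[OF finite_lists_length_eq[OF assms], of "\<lambda>xs. foldr (monoid.mult G) xs \<one>\<^bsub>G\<^esub>" n]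
    by (simp add: card_lists_length_eq[OF assms])
qed

lemma card_D_inf_split:
  assumes "S \<subseteq> carrier D_inf" "finite S"
  shows "card S = card (S \<inter> dihedral_reflections) + card (S \<inter> dihedral_translations)"
proof -
  have eq: "S = (S \<inter> dihedral_reflections) \<union> (S \<inter> dihedral_translations)"
    using assms(1) by (auto simp: dihedral_reflections_def dihedral_translations_def D_inf_def)
  have "(S \<inter> dihedral_reflections) \<inter> (S \<inter> dihedral_translations) = {}"
    by (auto simp: dihedral_reflections_def dihedral_translations_def)
  then have "card ((S \<inter> dihedral_reflections) \<union> (S \<inter> dihedral_translations)) =
      card (S \<inter> dihedral_reflections) + card (S \<inter> dihedral_translations)"
    using assms(2) by (intro card_Un_disjoint) auto
  then show ?thesis by (simp only: eq[symmetric])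
qed

lemma finite_gamma_set:
  "finite {card (set_power D_inf S n) | S. S \<subseteq> carrier D_inf \<and> finite S \<and> card S = k}"
  by (rule finite_subset[of _ "{..k ^ n}"]) (auto intro: card_set_power_le)

lemma gamma_refl_set_subset:
  assumes "p \<le> k"
  shows "{card (set_power D_inf S n) | S. S \<subseteq> carrier D_inf \<and> finite S \<and>
            card (S \<inter> dihedral_reflections) = p \<and> card (S \<inter> dihedral_translations) = k - p}
         \<subseteq> {card (set_power D_inf S n) | S. S \<subseteq> carrier D_inf \<and> finite S \<and> card S = k}"
proof
  fix c assume "c \<in> {card (set_power D_inf S n) | S. S \<subseteq> carrier D_inf \<and> finite S \<and>
            card (S \<inter> dihedral_reflections) = p \<and> card (S \<inter> dihedral_translations) = k - p}"
  then obtain S where S: "c = card (set_power D_inf S n)" "S \<subseteq> carrier D_inf" "finite S"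
    "card (S \<inter> dihedral_reflections) = p" "card (S \<inter> dihedral_translations) = k - p"
    by blast
  then have "card S = k"
    using card_D_inf_split[of S] assms by linarith
  with S show "c \<in> {card (set_power D_inf S n) | S. S \<subseteq> carrier D_inf \<and> finite S \<and> card S = k}"
    by blast
qed

lemma finite_gamma_refl_set:
  assumes "p \<le> k"
  shows "finite {card (set_power D_inf S n) | S. S \<subseteq> carrier D_inf \<and> finite S \<and>
            card (S \<inter> dihedral_reflections) = p \<and> card (S \<inter> dihedral_translations) = k - p}"
  using gamma_refl_set_subset[OF assms] finite_gamma_set by (rule finite_subset)

lemma gamma_refl_set_nonempty:
  "{card (set_power D_inf S n) | S. S \<subseteq> carrier D_inf \<and> finite S \<and>
      card (S \<inter> dihedral_reflections) = p \<and> card (S \<inter> dihedral_translations) = k - p} \<noteq> {}"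
proof -
  define R where "R = (\<lambda>i. (int i, -1::int)) ` {..<p}"
  define T where "T = (\<lambda>i. (int i, 1::int)) ` {..<k - p}"
  have "(R \<union> T) \<inter> dihedral_reflections = R" "(R \<union> T) \<inter> dihedral_translations = T"
    by (auto simp: R_def T_def dihedral_reflections_def dihedral_translations_def D_inf_def)
  moreover have "card R = p" "card T = k - p"
    by (simp_all add: R_def T_def card_image inj_on_def)
  moreover have "R \<union> T \<subseteq> carrier D_inf" "finite (R \<union> T)"
    by (auto simp: R_def T_def D_inf_def)
  ultimately show ?thesis
    unfolding ex_in_conv[symmetric] mem_Collect_eq
    by (intro exI[of _ "card (set_power D_inf (R \<union> T) n)"] exI[of _ "R \<union> T"]) simp
qed

lemma gamma_eq_Max_gamma_refl: "gamma k n = Max {gamma_refl k p n | p. p \<le> k}"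
proof -
  define A where "A = (\<lambda>p. {card (set_power D_inf S n) | S. S \<subseteq> carrier D_inf \<and> finite S \<and>
      card (S \<inter> dihedral_reflections) = p \<and> card (S \<inter> dihedral_translations) = k - p})"
  have "{card (set_power D_inf S n) | S. S \<subseteq> carrier D_inf \<and> finite S \<and> card S = k}
      \<subseteq> \<Union> (A ` {..k})"
  proof
    fix c assume "c \<in> {card (set_power D_inf S n) | S. S \<subseteq> carrier D_inf \<and> finite S \<and> card S = k}"
    then obtain S where S: "c = card (set_power D_inf S n)" "S \<subseteq> carrier D_inf" "finite S" "card S = k"
      by blast
    then have "card (S \<inter> dihedral_reflections) \<le> k" "card (S \<inter> dihedral_translations) = k - card (S \<inter> dihedral_reflections)"
      using card_D_inf_split[of S] by auto
    then show "c \<in> \<Union> (A ` {..k})" using S by (auto simp: A_def)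
  qed
  moreover have "\<Union> (A ` {..k})
      \<subseteq> {card (set_power D_inf S n) | S. S \<subseteq> carrier D_inf \<and> finite S \<and> card S = k}"
    unfolding A_def using gamma_refl_set_subset by (intro UN_least) simp
  ultimately have U: "gamma k n = Max (\<Union> (A ` {..k}))"
    by (simp add: gamma_def)
  have fin: "finite (A p)" if "p \<le> k" for p
    using finite_gamma_refl_set[OF that] by (simp add: A_def)
  have ne: "A p \<noteq> {}" for p
    unfolding A_def by (rule gamma_refl_set_nonempty)
  have eq: "{gamma_refl k p n | p. p \<le> k} = (\<lambda>p. Max (A p)) ` {..k}"
    by (auto simp: gamma_refl_def A_def)
  have finU: "finite (\<Union> (A ` {..k}))" using fin by auto
  have neU: "\<Union> (A ` {..k}) \<noteq> {}" using ne by auto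
  show ?thesis unfolding U eq
  proof (rule antisym)
    obtain p where p: "p \<le> k" "Max (\<Union> (A ` {..k})) \<in> A p"
      using Max_in[OF finU neU] by auto
    have "Max (\<Union> (A ` {..k})) \<le> Max (A p)" using p fin by simp
    also have "\<dots> \<le> Max ((\<lambda>p. Max (A p)) ` {..k})" using p by simp
    finally show "Max (\<Union> (A ` {..k})) \<le> Max ((\<lambda>p. Max (A p)) ` {..k})" .
    show "Max ((\<lambda>p. Max (A p)) ` {..k}) \<le> Max (\<Union> (A ` {..k}))"
    proof (rule Max.boundedI)
      fix a assume "a \<in> (\<lambda>p. Max (A p)) ` {..k}"
      then obtain p where "p \<le> k" "a = Max (A p)" by auto
      then show "a \<le> Max (\<Union> (A ` {..k}))"
        using Max_in[OF fin ne] finU by (auto intro!: Max_ge)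
    qed auto
  qed
qed

end

theory Submission
  imports Defs
begin

text \<open>
  Write $S$ as translations by $T$ and reflections at $D \cup \{r_0\}$. A word of length $n$ with at
  least one reflection evaluates to $\sum_t c_t t + \sum_{r \in D} d_r (r - r_0) + \varepsilon r_0$.
  Reflections carry alternating signs, so if $m = n - |c|$ letters remain after paying for the
  translations, then the positive entries of $d$ sum to at most $\lceil m/2 \rceil$ and the negative
  ones to at most $\lfloor m/2 \rfloor$; the parity of $n + |c|$ determines $\varepsilon$. Conversely
  every such $(c, d)$ for $n - 2$ is realised by a word of length $n$, the two spare letters being
  needed only when a translation has to be negated. Taking powers of a large base for $T$ and $D$
  makes the evaluation injective, so $\gamma(k,p,n)$ lies between the number of admissible pairs for
  $n - 2$ and for $n$. For $T = \emptyset$ this number is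
  $\sum_a \binom{p-1}{a} \binom{\lceil n/2 \rceil}{a} \binom{\lfloor n/2 \rfloor + p-1-a}{p-1-a}$,
  whose leading coefficient is given by $\sum_a \binom{p-1}{a}^2 = \binom{2p-2}{p-1}$, and each
  translation multiplies the generating function by $(1+x)/(1-x)$.
\<close>

subsection \<open>Counting integer vectors with bounded positive and negative mass\<close>

text \<open>Requiring zero outside \<open>A\<close> gives every integer vector indexed by
  \<open>A\<close> a single representative, so that cardinalities of such sets count
  vectors.\<close>

definition supported_on :: "'a set \<Rightarrow> ('a \<Rightarrow> int) set" where
  "supported_on A = {c. \<forall>x. x \<notin> A \<longrightarrow> c x = 0}"

definition l1_norm :: "'a set \<Rightarrow> ('a \<Rightarrow> int) \<Rightarrow> nat" where
  "l1_norm A c = (\<Sum>x\<in>A. nat \<bar>c x\<bar>)"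

definition pos_mass :: "'a set \<Rightarrow> ('a \<Rightarrow> int) \<Rightarrow> nat" where
  "pos_mass A c = (\<Sum>x\<in>A. nat (c x))"

definition neg_mass :: "'a set \<Rightarrow> ('a \<Rightarrow> int) \<Rightarrow> nat" where
  "neg_mass A c = (\<Sum>x\<in>A. nat (- c x))"

definition mass_box :: "'a set \<Rightarrow> nat \<Rightarrow> nat \<Rightarrow> ('a \<Rightarrow> int) set" where
  "mass_box A x y = {d \<in> supported_on A. pos_mass A d \<le> x \<and> neg_mass A d \<le> y}"

text \<open>The two budgets are the ceiling and the floor of half the letters left over: the signs
  of reflections alternate and the leftmost one is positive. The base reflection carries no
  coordinate of its own, so the masses are only bounded, not prescribed.\<close>

definition coords :: "'a set \<Rightarrow> 'b set \<Rightarrow> nat \<Rightarrow> (('a \<Rightarrow> int) \<times> ('b \<Rightarrow> int)) set" where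
  "coords T D n = {(c, d). c \<in> supported_on T \<and> l1_norm T c \<le> n \<and>
     d \<in> mass_box D ((n - l1_norm T c + 1) div 2) ((n - l1_norm T c) div 2)}"

text \<open>Old and new terms stand on opposite sides, so no subtraction occurs and the
  natural-number masses are covered.\<close>

lemma sum_fun_upd:
  fixes g :: "'a \<Rightarrow> 'b \<Rightarrow> 'c :: comm_monoid_add"
  assumes "finite A" "a \<in> A"
  shows "(\<Sum>x\<in>A. g x ((f(a := z)) x)) + g a (f a) = (\<Sum>x\<in>A. g x (f x)) + g a z"
proof -
  have "(\<Sum>x\<in>A. g x ((f(a := z)) x)) = g a z + (\<Sum>x\<in>A - {a}. g x (f x))"
    using assms by (subst sum.remove[of A a]) (auto intro!: sum.cong)
  moreover have "(\<Sum>x\<in>A. g x (f x)) = g a (f a) + (\<Sum>x\<in>A - {a}. g x (f x))"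
    using assms by (rule sum.remove)
  ultimately show ?thesis by (simp add: ac_simps)
qed

lemma sum_fun_upd_notin:
  "a \<notin> A \<Longrightarrow> (\<Sum>x\<in>A. g x ((f(a := z)) x)) = (\<Sum>x\<in>A. g x (f x))"
  by (rule sum.cong) auto

lemma l1_norm_upd:
  "finite A \<Longrightarrow> a \<in> A \<Longrightarrow> l1_norm A (c(a := z)) + nat \<bar>c a\<bar> = l1_norm A c + nat \<bar>z\<bar>"
  unfolding l1_norm_def using sum_fun_upd[of A a "\<lambda>_ v. nat \<bar>v\<bar>"] .

lemma pos_mass_upd:
  "finite A \<Longrightarrow> a \<in> A \<Longrightarrow> pos_mass A (c(a := z)) + nat (c a) = pos_mass A c + nat z"
  unfolding pos_mass_def using sum_fun_upd[of A a "\<lambda>_. nat"] .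

lemma neg_mass_upd:
  "finite A \<Longrightarrow> a \<in> A \<Longrightarrow> neg_mass A (c(a := z)) + nat (- c a) = neg_mass A c + nat (- z)"
  unfolding neg_mass_def using sum_fun_upd[of A a "\<lambda>_ v. nat (- v)"] .

lemma l1_norm_uminus [simp]: "l1_norm A (\<lambda>x. - c x) = l1_norm A c"
  by (simp add: l1_norm_def)

lemma pos_mass_uminus [simp]: "pos_mass A (\<lambda>x. - c x) = neg_mass A c"
  by (simp add: pos_mass_def neg_mass_def)

lemma neg_mass_uminus [simp]: "neg_mass A (\<lambda>x. - c x) = pos_mass A c"
  by (simp add: pos_mass_def neg_mass_def)

lemma mass_insert_upd:
  assumes "finite A" "a \<notin> A"
  shows "l1_norm (insert a A) (c(a := z)) = nat \<bar>z\<bar> + l1_norm A c"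
    "pos_mass (insert a A) (c(a := z)) = nat z + pos_mass A c"
    "neg_mass (insert a A) (c(a := z)) = nat (- z) + neg_mass A c"
  using assms sum_fun_upd_notin[OF assms(2), of "\<lambda>_ v. nat \<bar>v\<bar>" c z]
    sum_fun_upd_notin[OF assms(2), of "\<lambda>_ v. nat (- v)" c z]
    sum_fun_upd_notin[OF assms(2), of "\<lambda>_. nat" c z]
  by (simp_all add: l1_norm_def pos_mass_def neg_mass_def)

lemma supported_on_insert_iff:
  "c \<in> supported_on (insert a A) \<longleftrightarrow> c(a := 0) \<in> supported_on A"
  by (auto simp: supported_on_def)

lemma supported_on_upd: "a \<in> A \<Longrightarrow> c \<in> supported_on A \<Longrightarrow> c(a := z) \<in> supported_on A"
  by (auto simp: supported_on_def)

lemma supported_on_uminus: "c \<in> supported_on A \<Longrightarrow> (\<lambda>x. - c x) \<in> supported_on A"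
  by (auto simp: supported_on_def)

text \<open>Both signs are indexed by the budget that remains, \<open>x - z\<close> or
  \<open>y + z\<close>, so that counting by the value of one coordinate turns into a sum over
  smaller budgets.\<close>

lemma sum_int_interval:
  fixes f :: "int \<Rightarrow> 'b :: comm_monoid_add"
  shows "(\<Sum>z\<in>{- int y..int x}. f z) = f 0 + (\<Sum>i<x. f (int x - int i)) + (\<Sum>i<y. f (int i - int y))"
proof -
  have *: "{- int y..int x} = {0} \<union> ((\<lambda>i. int x - int i) ` {..<x} \<union> (\<lambda>i. int i - int y) ` {..<y})"
  proof (rule subset_antisym; rule subsetI)
    fix z assume z: "z \<in> {- int y..int x}"
    show "z \<in> {0} \<union> ((\<lambda>i. int x - int i) ` {..<x} \<union> (\<lambda>i. int i - int y) ` {..<y})"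
    proof (cases "z = 0")
      case False
      then consider "z > 0" | "z < 0" by linarith
      then show ?thesis
      proof cases
        case 1
        then show ?thesis using z by (intro UnI2 UnI1 image_eqI[of _ _ "nat (int x - z)"]) auto
      next
        case 2
        then show ?thesis using z by (intro UnI2 image_eqI[of _ _ "nat (z + int y)"]) auto
      qed
    qed simp
  qed auto
  have inj: "inj_on (\<lambda>i. int x - int i) {..<x}" "inj_on (\<lambda>i. int i - int y) {..<y}"
    by (auto simp: inj_on_def)
  have "(\<Sum>z\<in>{- int y..int x}. f z) = f 0 + (\<Sum>z\<in>((\<lambda>i. int x - int i) ` {..<x} \<union> (\<lambda>i. int i - int y) ` {..<y}). f z)"
    unfolding * by (subst sum.union_disjoint) auto
  also have "(\<Sum>z\<in>((\<lambda>i. int x - int i) ` {..<x} \<union> (\<lambda>i. int i - int y) ` {..<y}). f z)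
    = (\<Sum>i<x. f (int x - int i)) + (\<Sum>i<y. f (int i - int y))"
    by (subst sum.union_disjoint) (auto simp: sum.reindex[OF inj(1)] sum.reindex[OF inj(2)] o_def)
  finally show ?thesis by (simp add: add.assoc)
qed

section \<open>The number of vectors in a mass box\<close>

lemma mass_box_empty: "mass_box {} x y = {\<lambda>_. 0}"
  by (auto simp: mass_box_def supported_on_def pos_mass_def neg_mass_def)

text \<open>Splits off the value \<open>z\<close> at \<open>a\<close>, which uses up
  \<open>nat z\<close> of the positive and \<open>nat (- z)\<close> of the negative budget. The
  range of \<open>z\<close> keeps the truncated subtractions exact.\<close>

lemma bij_betw_mass_box_insert:
  assumes "finite D" "a \<notin> D"
  shows "bij_betw (\<lambda>(z, d). d(a := z))
    (SIGMA z:{- int y..int x}. mass_box D (x - nat z) (y - nat (- z))) (mass_box (insert a D) x y)"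
proof (rule bij_betw_byWitness[where f' = "\<lambda>d. (d a, d(a := 0))"])
  show "\<forall>u\<in>SIGMA z:{- int y..int x}. mass_box D (x - nat z) (y - nat (- z)).
      (\<lambda>d. (d a, d(a := 0))) ((\<lambda>(z, d). d(a := z)) u) = u"
    using assms by (auto simp: mass_box_def supported_on_def)
  show "\<forall>d\<in>mass_box (insert a D) x y. (\<lambda>(z, d). d(a := z)) (d a, d(a := 0)) = d"
    by auto
  show "(\<lambda>(z, d). d(a := z)) ` (SIGMA z:{- int y..int x}. mass_box D (x - nat z) (y - nat (- z)))
      \<subseteq> mass_box (insert a D) x y"
    using assms by (auto simp: mass_box_def mass_insert_upd supported_on_def)
  show "(\<lambda>d. (d a, d(a := 0))) ` mass_box (insert a D) x y
      \<subseteq> (SIGMA z:{- int y..int x}. mass_box D (x - nat z) (y - nat (- z)))"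
  proof clarify
    fix d assume d: "d \<in> mass_box (insert a D) x y"
    have "pos_mass (insert a D) d = nat (d a) + pos_mass D (d(a := 0))"
      "neg_mass (insert a D) d = nat (- d a) + neg_mass D (d(a := 0))"
      using mass_insert_upd[OF assms, of "d(a := 0)" "d a"] by simp_all
    with d show "d a \<in> {- int y..int x} \<and> d(a := 0) \<in> mass_box D (x - nat (d a)) (y - nat (- d a))"
      by (auto simp: mass_box_def supported_on_insert_iff)
  qed
qed

lemma finite_mass_box: "finite D \<Longrightarrow> finite (mass_box D x y)"
proof (induction D arbitrary: x y rule: finite_induct)
  case (insert a D)
  then show ?case
    using bij_betw_finite[OF bij_betw_mass_box_insert[OF insert.hyps, of y x]] by auto
qed (simp add: mass_box_empty)

lemma card_mass_box_insert:
  assumes "finite D" "a \<notin> D"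
  shows "card (mass_box (insert a D) x y) =
    card (mass_box D x y) + (\<Sum>i<x. card (mass_box D i y)) + (\<Sum>i<y. card (mass_box D x i))"
proof -
  have "card (mass_box (insert a D) x y) = (\<Sum>z\<in>{- int y..int x}. card (mass_box D (x - nat z) (y - nat (- z))))"
    using bij_betw_same_card[OF bij_betw_mass_box_insert[OF assms, of y x]] assms
    by (simp add: finite_mass_box)
  then show ?thesis
    by (simp add: sum_int_interval nat_diff_distrib)
qed

text \<open>The index \<open>a\<close> is the number of positive entries: choose their places, then
  \<open>a\<close> positive integers of sum at most \<open>x\<close>, then \<open>m - a\<close>
  nonnegative integers of sum at most \<open>y\<close> for the negated remaining entries.\<close>

definition box_count :: "nat \<Rightarrow> nat \<Rightarrow> nat \<Rightarrow> nat" where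
  "box_count m x y = (\<Sum>a\<le>m. (m choose a) * (x choose a) * ((y + (m - a)) choose (m - a)))"

text \<open>This and the next lemma are two forms of the hockey-stick identity.\<close>

lemma sum_choose_left: "(\<Sum>i<x. i choose a) = x choose Suc a"
  by (induction x) simp_all

lemma sum_choose_right: "(\<Sum>j<y. (j + b) choose b) = (y + b) choose Suc b"
  by (induction y) simp_all

text \<open>Summation over one budget raises the lower index of the matching binomial coefficient.
  Pascal's rule then applies twice: in the second budget it merges the first and last sums, and in
  \<open>m choose a\<close> it merges the result with the middle sum.\<close>

lemma box_count_Suc:
  "box_count (Suc m) x y = box_count m x y + (\<Sum>i<x. box_count m i y) + (\<Sum>j<y. box_count m x j)"
proof -
  define h where "h a = (x choose a) * ((y + (Suc m - a)) choose (Suc m - a))" for a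
  have *: "(m choose a) * (x choose a) * ((y + (m - a)) choose (m - a)) +
      (m choose a) * (x choose a) * ((y + (m - a)) choose Suc (m - a)) = (m choose a) * h a"
    if "a \<le> m" for a
    using that by (simp add: h_def Suc_diff_le algebra_simps)
  have "box_count m x y + (\<Sum>i<x. box_count m i y) + (\<Sum>j<y. box_count m x j) =
    (\<Sum>a\<le>m. (m choose a) * (x choose a) * ((y + (m - a)) choose (m - a)))
     + (\<Sum>a\<le>m. (m choose a) * (x choose Suc a) * ((y + (m - a)) choose (m - a)))
     + (\<Sum>a\<le>m. (m choose a) * (x choose a) * ((y + (m - a)) choose Suc (m - a)))"
    unfolding box_count_def sum.swap[of _ _ "{..<x}"] sum.swap[of _ _ "{..<y}"]
    by (simp add: sum_choose_left sum_choose_right del: add_diff_assoc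
        flip: sum_distrib_left sum_distrib_right)
  also have "\<dots> = (\<Sum>a\<le>m. (m choose a) * (x choose a) * ((y + (m - a)) choose (m - a)) +
      (m choose a) * (x choose a) * ((y + (m - a)) choose Suc (m - a))) + (\<Sum>a\<le>m. (m choose a) * h (Suc a))"
    by (simp add: h_def mult.assoc sum.distrib)
  also have "(\<Sum>a\<le>m. (m choose a) * (x choose a) * ((y + (m - a)) choose (m - a)) +
      (m choose a) * (x choose a) * ((y + (m - a)) choose Suc (m - a))) = (\<Sum>a\<le>m. (m choose a) * h a)"
    by (intro sum.cong refl *) simp
  \<comment> \<open>The added term vanishes because \<open>m choose Suc m\<close> is 0; it aligns
    the sum for the index shift.\<close>
  also have "(\<Sum>a\<le>m. (m choose a) * h a) = (\<Sum>a\<le>Suc m. (m choose a) * h a)"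
    by simp
  also have "\<dots> = h 0 + (\<Sum>a\<le>m. (m choose Suc a) * h (Suc a))"
    by (subst sum.atMost_Suc_shift) simp
  also have "\<dots> + (\<Sum>a\<le>m. (m choose a) * h (Suc a)) = (\<Sum>a\<le>Suc m. (Suc m choose a) * h a)"
    by (subst sum.atMost_Suc_shift) (simp add: algebra_simps sum.distrib)
  also have "\<dots> = box_count (Suc m) x y"
    by (simp add: box_count_def h_def mult.assoc)
  finally show ?thesis by simp
qed

lemma card_mass_box: "finite D \<Longrightarrow> card (mass_box D x y) = box_count (card D) x y"
proof (induction D arbitrary: x y rule: finite_induct)
  case empty
  then show ?case by (simp add: mass_box_empty box_count_def)
qed (simp add: card_mass_box_insert box_count_Suc)

section \<open>The number of admissible coordinate pairs\<close>

lemma bij_betw_coords_empty: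
  "bij_betw (\<lambda>d. (\<lambda>_. 0, d)) (mass_box D ((n + 1) div 2) (n div 2)) (coords {} D n)"
  by (rule bij_betw_byWitness[where f' = snd])
    (auto simp: coords_def supported_on_def l1_norm_def)

text \<open>An exponent \<open>z\<close> of the new translation costs
  \<open>nat \<bar>z\<bar>\<close> letters whatever its sign. Hence \<open>z\<close> and
  \<open>- z\<close> leave the same count, which is the factor 2 in
  \<open>coord_count\<close>.\<close>

lemma bij_betw_coords_insert:
  assumes "finite T" "t \<notin> T"
  shows "bij_betw (\<lambda>(z, c, d). (c(t := z), d))
    (SIGMA z:{- int n..int n}. coords T D (n - nat \<bar>z\<bar>)) (coords (insert t T) D n)"
proof (rule bij_betw_byWitness[where f' = "\<lambda>(c, d). (c t, c(t := 0), d)"])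
  show "\<forall>u\<in>SIGMA z:{- int n..int n}. coords T D (n - nat \<bar>z\<bar>).
      (\<lambda>(c, d). (c t, c(t := 0), d)) ((\<lambda>(z, c, d). (c(t := z), d)) u) = u"
    using assms by (auto simp: coords_def supported_on_def)
  show "\<forall>u\<in>coords (insert t T) D n. (\<lambda>(z, c, d). (c(t := z), d)) ((\<lambda>(c, d). (c t, c(t := 0), d)) u) = u"
    by auto
  show "(\<lambda>(z, c, d). (c(t := z), d)) ` (SIGMA z:{- int n..int n}. coords T D (n - nat \<bar>z\<bar>))
      \<subseteq> coords (insert t T) D n"
    using assms by (auto simp: coords_def mass_insert_upd supported_on_def)
  show "(\<lambda>(c, d). (c t, c(t := 0), d)) ` coords (insert t T) D n
      \<subseteq> (SIGMA z:{- int n..int n}. coords T D (n - nat \<bar>z\<bar>))"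
  proof clarify
    fix c d assume c: "(c, d) \<in> coords (insert t T) D n"
    have "l1_norm (insert t T) c = nat \<bar>c t\<bar> + l1_norm T (c(t := 0))"
      using mass_insert_upd(1)[OF assms, of "c(t := 0)" "c t"] by simp
    with c show "c t \<in> {- int n..int n} \<and> (c(t := 0), d) \<in> coords T D (n - nat \<bar>c t\<bar>)"
      by (auto simp: coords_def supported_on_insert_iff)
  qed
qed

lemma finite_coords: "finite T \<Longrightarrow> finite D \<Longrightarrow> finite (coords T D n)"
proof (induction T arbitrary: n rule: finite_induct)
  case empty
  then show ?case
    using bij_betw_finite[OF bij_betw_coords_empty[of D n]] finite_mass_box by blast
next
  case (insert t T)
  then show ?case
    using bij_betw_finite[OF bij_betw_coords_insert[OF insert.hyps, of n D]] by auto
qed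

fun coord_count :: "nat \<Rightarrow> nat \<Rightarrow> nat \<Rightarrow> nat" where
  "coord_count 0 m n = box_count m ((n + 1) div 2) (n div 2)"
| "coord_count (Suc q) m n = coord_count q m n + 2 * (\<Sum>i<n. coord_count q m i)"

lemma card_coords:
  "finite T \<Longrightarrow> finite D \<Longrightarrow> card (coords T D n) = coord_count (card T) (card D) n"
proof (induction T arbitrary: n rule: finite_induct)
  case empty
  then show ?case
    by (simp add: card_mass_box flip: bij_betw_same_card[OF bij_betw_coords_empty])
next
  case (insert t T)
  have "card (coords (insert t T) D n) = (\<Sum>z\<in>{- int n..int n}. card (coords T D (n - nat \<bar>z\<bar>)))"
    using bij_betw_same_card[OF bij_betw_coords_insert[OF insert.hyps, of n D]] insert
    by (simp add: finite_coords)
  also have "\<dots> = card (coords T D n) + 2 * (\<Sum>i<n. card (coords T D i))"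
    by (simp add: sum_int_interval nat_diff_distrib)
  finally show ?case
    using insert by simp
qed

subsection \<open>Evaluation of words in the infinite dihedral group\<close>

definition dihedral_set :: "int set \<Rightarrow> int set \<Rightarrow> (int \<times> int) set" where
  "dihedral_set T R = (\<lambda>t. (t, 1)) ` T \<union> (\<lambda>r. (r, -1)) ` R"

text \<open>The number of reflections in a word has the parity of \<open>n + l1_norm T c\<close>, so
  their alternating signs add up to 0 or 1. Rewriting each \<open>r\<close> as
  \<open>(r - r0) + r0\<close> therefore leaves a single \<open>of_bool\<close> multiple of
  \<open>r0\<close>.\<close>

definition dihedral_eval ::
    "int set \<Rightarrow> int set \<Rightarrow> int \<Rightarrow> nat \<Rightarrow> (int \<Rightarrow> int) \<times> (int \<Rightarrow> int) \<Rightarrow> int \<times> int" where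
  "dihedral_eval T D r0 n = (\<lambda>(c, d).
     ((\<Sum>t\<in>T. c t * t) + (\<Sum>r\<in>D. d r * (r - r0)) + of_bool (odd (n + l1_norm T c)) * r0,
      if odd (n + l1_norm T c) then -1 else 1))"

lemma set_power_0: "set_power G S 0 = {\<one>\<^bsub>G\<^esub>}"
  by (auto simp: set_power_def)

lemma set_power_Suc: "set_power G S (Suc n) = {s \<otimes>\<^bsub>G\<^esub> x | s x. s \<in> S \<and> x \<in> set_power G S n}"
proof (intro subset_antisym subsetI)
  fix y assume "y \<in> set_power G S (Suc n)"
  then obtain xs where "length xs = Suc n" "set xs \<subseteq> S" "y = foldr (monoid.mult G) xs \<one>\<^bsub>G\<^esub>"
    by (auto simp: set_power_def)
  then show "y \<in> {s \<otimes>\<^bsub>G\<^esub> x | s x. s \<in> S \<and> x \<in> set_power G S n}"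
    by (cases xs) (auto simp: set_power_def)
next
  fix y assume "y \<in> {s \<otimes>\<^bsub>G\<^esub> x | s x. s \<in> S \<and> x \<in> set_power G S n}"
  then obtain s xs where "length xs = n" "set xs \<subseteq> S" "s \<in> S"
    "y = s \<otimes>\<^bsub>G\<^esub> foldr (monoid.mult G) xs \<one>\<^bsub>G\<^esub>"
    by (auto simp: set_power_def)
  then show "y \<in> set_power G S (Suc n)"
    unfolding set_power_def by (intro CollectI exI[of _ "s # xs"]) auto
qed

lemma D_inf_mult: "(a, b) \<otimes>\<^bsub>D_inf\<^esub> (a', b') = (a + b * a', b * b')"
  and D_inf_one: "\<one>\<^bsub>D_inf\<^esub> = (0, 1)"
  by (simp_all add: D_inf_def)

lemma set_power_D_inf_mult:
  "s \<in> S \<Longrightarrow> (a, b) \<in> set_power D_inf S n \<Longrightarrow> (fst s + snd s * a, snd s * b) \<in> set_power D_inf S (Suc n)"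
  unfolding set_power_Suc
  by (intro CollectI exI[of _ s] exI[of _ "(a, b)"]) (simp flip: D_inf_mult)

lemma l1_norm_add_one:
  assumes "finite T" "t \<in> T"
  shows "l1_norm T (c(t := c t + 1)) = (if c t \<ge> 0 then l1_norm T c + 1 else l1_norm T c - 1)"
    and "c t < 0 \<Longrightarrow> l1_norm T c > 0"
  using l1_norm_upd[OF assms, of c "c t + 1"] by auto

text \<open>The norm changes by one, up or down. The number of letters left over thus stays the same
  or grows by 2, and the parity of length plus norm is preserved.\<close>

lemma coords_mult_translation:
  assumes "finite T" "t \<in> T" "(c, d) \<in> coords T D n"
  shows "(c(t := c t + 1), d) \<in> coords T D (Suc n)"
    and "odd (Suc n + l1_norm T (c(t := c t + 1))) \<longleftrightarrow> odd (n + l1_norm T c)"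
proof -
  let ?c = "c(t := c t + 1)"
  have c: "c \<in> supported_on T" "l1_norm T c \<le> n"
    "d \<in> mass_box D ((n - l1_norm T c + 1) div 2) ((n - l1_norm T c) div 2)"
    using assms(3) by (auto simp: coords_def)
  have le: "l1_norm T ?c \<le> Suc n" "n - l1_norm T c \<le> Suc n - l1_norm T ?c"
    using l1_norm_add_one[OF assms(1,2), of c] c(2) by auto
  have "d \<in> mass_box D ((Suc n - l1_norm T ?c + 1) div 2) ((Suc n - l1_norm T ?c) div 2)"
    using c(3) div_le_mono[OF le(2), of 2] div_le_mono[of "n - l1_norm T c + 1" "Suc n - l1_norm T ?c + 1" 2] le(2)
    by (auto simp: mass_box_def)
  then show "(?c, d) \<in> coords T D (Suc n)"
    using le c(1) supported_on_upd[OF assms(2) c(1)] by (simp add: coords_def)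
  show "odd (Suc n + l1_norm T ?c) \<longleftrightarrow> odd (n + l1_norm T c)"
    using l1_norm_add_one[OF assms(1,2), of c] by (cases "c t \<ge> 0") auto
qed

text \<open>A reflection put in front negates all coordinates, which swaps the two masses, and then
  adds 1 at its own place. Floor and ceiling of \<open>m / 2\<close> become exactly the budgets for
  \<open>m + 1\<close> letters.\<close>

lemma mass_box_reflect:
  assumes "finite D" "d \<in> mass_box D x y" "i \<in> D"
  shows "(\<lambda>r. - d r)(i := 1 - d i) \<in> mass_box D (y + 1) x"
proof -
  have "pos_mass D ((\<lambda>r. - d r)(i := 1 - d i)) + nat (- d i) = neg_mass D d + nat (1 - d i)"
    "neg_mass D ((\<lambda>r. - d r)(i := 1 - d i)) + nat (d i) = pos_mass D d + nat (d i - 1)"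
    using pos_mass_upd[OF assms(1,3), of "\<lambda>r. - d r" "1 - d i"]
      neg_mass_upd[OF assms(1,3), of "\<lambda>r. - d r" "1 - d i"] by simp_all
  then show ?thesis
    using assms(2) supported_on_upd[OF assms(3) supported_on_uminus, of d]
    by (auto simp: mass_box_def)
qed

lemma mass_box_mono: "x \<le> x' \<Longrightarrow> y \<le> y' \<Longrightarrow> mass_box D x y \<subseteq> mass_box D x' y'"
  by (auto simp: mass_box_def)

lemma sum_coord_upd:
  fixes f :: "'a \<Rightarrow> int"
  assumes "finite A" "a \<in> A"
  shows "(\<Sum>x\<in>A. (f(a := z)) x * w x) = (\<Sum>x\<in>A. f x * w x) + (z - f a) * w a"
  using sum_fun_upd[OF assms, of "\<lambda>x v. v * w x" f z] by (simp add: algebra_simps)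

text \<open>Induction on the length, by multiplication with a new first letter: a translation raises
  one entry of \<open>c\<close>, a reflection negates \<open>c\<close> and \<open>d\<close> and
  raises at most one entry of \<open>d\<close>.\<close>

lemma set_power_subset_eval:
  assumes "finite T" "finite D"
  shows "set_power D_inf (dihedral_set T (insert r0 D)) n \<subseteq> dihedral_eval T D r0 n ` coords T D n"
proof (induction n)
  case 0
  have "(\<lambda>_. 0, \<lambda>_. 0) \<in> coords T D 0"
    by (auto simp: coords_def mass_box_def supported_on_def l1_norm_def pos_mass_def neg_mass_def)
  moreover have "dihedral_eval T D r0 0 (\<lambda>_. 0, \<lambda>_. 0) = (0, 1)"
    by (simp add: dihedral_eval_def l1_norm_def)
  ultimately show ?case
    by (auto simp: set_power_0 D_inf_one intro!: image_eqI)
next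
  case (Suc n)
  let ?S = "dihedral_set T (insert r0 D)"
  show ?case
  proof
    fix y assume "y \<in> set_power D_inf ?S (Suc n)"
    then obtain s x where sx: "s \<in> ?S" "x \<in> set_power D_inf ?S n" "y = s \<otimes>\<^bsub>D_inf\<^esub> x"
      by (auto simp: set_power_Suc)
    with Suc.IH obtain u where "u \<in> coords T D n" "x = dihedral_eval T D r0 n u"
      by blast
    then obtain c d where cd: "(c, d) \<in> coords T D n" "x = dihedral_eval T D r0 n (c, d)"
      by (cases u) simp
    then have c: "c \<in> supported_on T" "l1_norm T c \<le> n"
        "d \<in> mass_box D ((n - l1_norm T c + 1) div 2) ((n - l1_norm T c) div 2)"
      by (auto simp: coords_def)
    from sx(1) consider (transl) t where "t \<in> T" "s = (t, 1)" | (refl) r where "r \<in> insert r0 D" "s = (r, -1)"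
      by (auto simp: dihedral_set_def)
    then show "y \<in> dihedral_eval T D r0 (Suc n) ` coords T D (Suc n)"
    proof cases
      case transl
      have "y = dihedral_eval T D r0 (Suc n) (c(t := c t + 1), d)"
        unfolding sx(3) cd(2) transl(2) dihedral_eval_def prod.case D_inf_mult
          coords_mult_translation(2)[OF assms(1) transl(1) cd(1)]
        using sum_coord_upd[OF assms(1) transl(1), of c "c t + 1" "\<lambda>x. x"] by simp
      then show ?thesis
        using coords_mult_translation(1)[OF assms(1) transl(1) cd(1)] by blast
    next
      case refl
      \<comment> \<open>A reflection at \<open>r0\<close> outside \<open>D\<close> has no
        coordinate; its weight \<open>r - r0\<close> is 0, so negation alone suffices.\<close>
      define e where "e = (if r \<in> D then (\<lambda>x. - d x)(r := 1 - d r) else (\<lambda>x. - d x))"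
      have e1: "e \<in> mass_box D ((n - l1_norm T c) div 2 + 1) ((n - l1_norm T c + 1) div 2)"
        using mass_box_reflect[OF assms(2) c(3), of r] c(3)
        by (auto simp: e_def mass_box_def supported_on_uminus)
      have "(\<lambda>x. - c x, e) \<in> coords T D (Suc n)"
        using c e1 supported_on_uminus[OF c(1)] by (simp add: coords_def Suc_diff_le)
      moreover have e2: "(\<Sum>x\<in>D. e x * (x - r0)) = (r - r0) - (\<Sum>x\<in>D. d x * (x - r0))"
      proof (cases "r \<in> D")
        case True
        then show ?thesis
          using sum_coord_upd[OF assms(2) True, of "\<lambda>x. - d x" "1 - d r" "\<lambda>x. x - r0"]
          by (simp add: e_def sum_negf)
      next
        case False
        then show ?thesis using refl(1) by (simp add: e_def sum_negf)
      qed
      \<comment> \<open>Negation keeps the norm while the length grows by one, so the parity flips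
        and \<open>r0 - of_bool b * r0\<close> is the new parity term.\<close>
      have "y = dihedral_eval T D r0 (Suc n) (\<lambda>x. - c x, e)"
        unfolding sx(3) cd(2) refl(2) dihedral_eval_def prod.case D_inf_mult e2
        by (simp add: sum_negf)
      ultimately show ?thesis by blast
    qed
  qed
qed

text \<open>The first letter is read off from the coordinates: a translation as long as some entry
  of \<open>c\<close> is positive, otherwise a reflection, which makes all entries of
  \<open>c\<close> nonnegative. The side condition guarantees a spare letter for that reflection if
  negative entries occur.\<close>

lemma eval_in_set_power:
  assumes "finite T" "finite D"
  shows "(c, d) \<in> coords T D n \<Longrightarrow> (\<forall>t. c t \<ge> 0) \<or> l1_norm T c < n \<Longrightarrow>
    dihedral_eval T D r0 n (c, d) \<in> set_power D_inf (dihedral_set T (insert r0 D)) n"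
proof (induction n arbitrary: c d)
  case 0
  then have "l1_norm T c = 0" "pos_mass D d = 0" "neg_mass D d = 0"
    by (auto simp: coords_def mass_box_def)
  then have "\<forall>t\<in>T. c t = 0" "\<forall>r\<in>D. d r = 0"
    using assms by (force simp: l1_norm_def pos_mass_def neg_mass_def)+
  then show ?case
    using \<open>l1_norm T c = 0\<close> by (simp add: dihedral_eval_def set_power_0 D_inf_one)
next
  case (Suc n)
  let ?S = "dihedral_set T (insert r0 D)"
  have c: "c \<in> supported_on T" "l1_norm T c \<le> Suc n"
    "d \<in> mass_box D ((Suc n - l1_norm T c + 1) div 2) ((Suc n - l1_norm T c) div 2)"
    using Suc.prems by (auto simp: coords_def)
  show ?case
  proof (cases "\<exists>t\<in>T. c t > 0")
    case True
    then obtain t where t: "t \<in> T" "c t > 0" by blast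
    define c' where "c' = c(t := c t - 1)"
    have c_eq: "c = c'(t := c' t + 1)" by (simp add: c'_def)
    have norm: "l1_norm T c = Suc (l1_norm T c')"
      using l1_norm_upd[OF assms(1) t(1), of c "c t - 1"] t(2) by (simp add: c'_def)
    have c': "(c', d) \<in> coords T D n"
      using c norm supported_on_upd[OF t(1) c(1)] by (simp add: coords_def c'_def)
    moreover have "(\<forall>t. c' t \<ge> 0) \<or> l1_norm T c' < n"
      using Suc.prems(2) norm t(2) by (auto simp: c'_def)
    ultimately have "dihedral_eval T D r0 n (c', d) \<in> set_power D_inf ?S n"
      by (rule Suc.IH)
    then have "(t + 1 * fst (dihedral_eval T D r0 n (c', d)), 1 * snd (dihedral_eval T D r0 n (c', d)))
        \<in> set_power D_inf ?S (Suc n)"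
      using set_power_D_inf_mult[of "(t, 1)" ?S] t(1) by (simp add: dihedral_set_def)
    also have "(t + 1 * fst (dihedral_eval T D r0 n (c', d)), 1 * snd (dihedral_eval T D r0 n (c', d))) =
        dihedral_eval T D r0 (Suc n) (c, d)"
      using sum_coord_upd[OF assms(1) t(1), of c' "c' t + 1" "\<lambda>x. x"]
      by (simp add: dihedral_eval_def norm flip: c_eq)
    finally show ?thesis .
  next
    case False
    have le0: "c t \<le> 0" for t
      using False c(1) by (cases "t \<in> T") (auto simp: supported_on_def)
    have less: "l1_norm T c < Suc n"
      using Suc.prems(2)
    proof
      assume "\<forall>t. c t \<ge> 0"
      then have "c t = 0" for t using le0 by (simp add: antisym)
      then show ?thesis by (simp add: l1_norm_def)
    qed
    \<comment> \<open>After the swap the new negative budget is one less than the old positive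
      budget. Thus a reflection with positive coordinate is used if there is one; otherwise the
      positive mass is already 0 and \<open>r0\<close> will do.\<close>
    have "\<exists>r e. r \<in> insert r0 D \<and> e \<in> mass_box D ((n - l1_norm T c + 1) div 2) ((n - l1_norm T c) div 2)
        \<and> (\<Sum>x\<in>D. e x * (x - r0)) = (r - r0) - (\<Sum>x\<in>D. d x * (x - r0))"
    proof (cases "\<exists>r\<in>D. d r > 0")
      case True
      then obtain r where r: "r \<in> D" "d r > 0" by blast
      define e where "e = (\<lambda>x. - d x)(r := 1 - d r)"
      have "pos_mass D e = neg_mass D d" "neg_mass D e + 1 = pos_mass D d"
        using pos_mass_upd[OF assms(2) r(1), of "\<lambda>r. - d r" "1 - d r"]
          neg_mass_upd[OF assms(2) r(1), of "\<lambda>r. - d r" "1 - d r"] r(2) by (simp_all add: e_def)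
      then have "e \<in> mass_box D ((n - l1_norm T c + 1) div 2) ((n - l1_norm T c) div 2)"
        using c(3) less supported_on_upd[OF r(1) supported_on_uminus, of d]
        by (auto simp: mass_box_def e_def Suc_diff_le)
      moreover have "(\<Sum>x\<in>D. e x * (x - r0)) = (r - r0) - (\<Sum>x\<in>D. d x * (x - r0))"
        using sum_coord_upd[OF assms(2) r(1), of "\<lambda>x. - d x" "1 - d r" "\<lambda>x. x - r0"]
        by (simp add: e_def sum_negf)
      ultimately show ?thesis using r(1) by blast
    next
      case False
      then have "pos_mass D d = 0" unfolding pos_mass_def by (intro sum.neutral) (simp add: not_less)
      then have "(\<lambda>x. - d x) \<in> mass_box D ((n - l1_norm T c + 1) div 2) ((n - l1_norm T c) div 2)"
        using c(3) less by (auto simp: mass_box_def supported_on_uminus Suc_diff_le)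
      then show ?thesis
        by (intro exI[of _ r0] exI[of _ "\<lambda>x. - d x"]) (simp add: sum_negf)
    qed
    then obtain r e where r: "r \<in> insert r0 D"
      and e: "e \<in> mass_box D ((n - l1_norm T c + 1) div 2) ((n - l1_norm T c) div 2)"
        "(\<Sum>x\<in>D. e x * (x - r0)) = (r - r0) - (\<Sum>x\<in>D. d x * (x - r0))"
      by blast
    have "(\<lambda>x. - c x, e) \<in> coords T D n"
      using e(1) less supported_on_uminus[OF c(1)] by (simp add: coords_def)
    then have "dihedral_eval T D r0 n (\<lambda>x. - c x, e) \<in> set_power D_inf ?S n"
      by (rule Suc.IH) (use le0 in auto)
    moreover have "(r, -1) \<in> ?S" using r by (auto simp: dihedral_set_def)
    ultimately have "(r + - 1 * fst (dihedral_eval T D r0 n (\<lambda>x. - c x, e)), - 1 * snd (dihedral_eval T D r0 n (\<lambda>x. - c x, e)))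
        \<in> set_power D_inf ?S (Suc n)"
      using set_power_D_inf_mult[of "(r, -1)" ?S] by fastforce
    also have "(r + - 1 * fst (dihedral_eval T D r0 n (\<lambda>x. - c x, e)), - 1 * snd (dihedral_eval T D r0 n (\<lambda>x. - c x, e))) =
        dihedral_eval T D r0 (Suc n) (c, d)"
      by (simp add: dihedral_eval_def e(2) sum_negf)
    finally show ?thesis .
  qed
qed

lemma coords_mono2: "(c, d) \<in> coords T D n \<Longrightarrow> (c, d) \<in> coords T D (n + 2)"
  by (auto simp: coords_def intro: subsetD[OF mass_box_mono, rotated -1])

text \<open>Two further letters preserve the parity, hence the evaluation, and make the norm smaller
  than the length, so the side condition of \<open>eval_in_set_power\<close> always holds.\<close>

lemma eval_image_subset_set_power:
  assumes "finite T" "finite D"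
  shows "dihedral_eval T D r0 n ` coords T D n
    \<subseteq> set_power D_inf (dihedral_set T (insert r0 D)) (n + 2)"
proof clarify
  fix a b c d assume ab: "(c, d) \<in> coords T D n" "(a, b) = dihedral_eval T D r0 n (c, d)"
  have "dihedral_eval T D r0 (n + 2) (c, d) = dihedral_eval T D r0 n (c, d)"
    by (simp add: dihedral_eval_def)
  with ab eval_in_set_power[OF assms coords_mono2[OF ab(1)], of r0]
  show "(a, b) \<in> set_power D_inf (dihedral_set T (insert r0 D)) (n + 2)"
    by (auto simp: coords_def)
qed

section \<open>Sets consisting of translations only\<close>

text \<open>Translations commute, so only the number of occurrences of each letter matters. The
  letter \<open>t0\<close> fills the remaining places, and no sign change occurs, whence the
  negative budget 0.\<close>

lemma set_power_translations_subset:
  assumes "finite D"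
  shows "set_power D_inf (dihedral_set (insert t0 D) {}) n
    \<subseteq> (\<lambda>d. (int n * t0 + (\<Sum>t\<in>D. d t * (t - t0)), 1)) ` mass_box D n 0"
proof (induction n)
  case 0
  have "(\<lambda>_. 0) \<in> mass_box D 0 0"
    by (auto simp: mass_box_def supported_on_def pos_mass_def neg_mass_def)
  then show ?case
    by (auto simp: set_power_0 D_inf_one intro!: image_eqI)
next
  case (Suc n)
  show ?case
  proof
    fix y assume "y \<in> set_power D_inf (dihedral_set (insert t0 D) {}) (Suc n)"
    then obtain t x where t: "t \<in> insert t0 D" "x \<in> set_power D_inf (dihedral_set (insert t0 D) {}) n"
      "y = (t, 1) \<otimes>\<^bsub>D_inf\<^esub> x"
      by (auto simp: set_power_Suc dihedral_set_def)
    with Suc.IH obtain d where d: "d \<in> mass_box D n 0" "x = (int n * t0 + (\<Sum>t\<in>D. d t * (t - t0)), 1)"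
      by blast
    define e where "e = (if t \<in> D then d(t := d t + 1) else d)"
    have "e \<in> mass_box D (Suc n) 0"
      using d(1) pos_mass_upd[OF assms, of t d "d t + 1"] neg_mass_upd[OF assms, of t d "d t + 1"]
      by (auto simp: mass_box_def e_def supported_on_upd)
    moreover have "(\<Sum>x\<in>D. e x * (x - t0)) = (t - t0) + (\<Sum>x\<in>D. d x * (x - t0))"
      using t(1) sum_coord_upd[OF assms, of t d "d t + 1" "\<lambda>x. x - t0"] by (auto simp: e_def)
    then have "y = (int (Suc n) * t0 + (\<Sum>x\<in>D. e x * (x - t0)), 1)"
      unfolding t(3) d(2) D_inf_mult by (simp add: algebra_simps)
    ultimately show "y \<in> (\<lambda>d. (int (Suc n) * t0 + (\<Sum>t\<in>D. d t * (t - t0)), 1)) ` mass_box D (Suc n) 0"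
      by blast
  qed
qed

section \<open>Upper bounds for the growth functions\<close>

lemma D_inf_subset_split:
  assumes "S \<subseteq> carrier D_inf"
  shows "S = dihedral_set (fst ` (S \<inter> dihedral_translations)) (fst ` (S \<inter> dihedral_reflections))"
proof -
  have *: "(\<lambda>t. (t, b)) ` fst ` X = X" if "\<And>x. x \<in> X \<Longrightarrow> snd x = b" for X :: "(int \<times> int) set" and b
  proof -
    have "(\<lambda>t. (t, b)) ` fst ` X = (\<lambda>x. x) ` X"
      unfolding image_image by (rule image_cong) (simp_all add: prod_eq_iff that)
    then show ?thesis by simp
  qed
  have "(\<lambda>t. (t, 1)) ` fst ` (S \<inter> dihedral_translations) = S \<inter> dihedral_translations"
    "(\<lambda>r. (r, -1)) ` fst ` (S \<inter> dihedral_reflections) = S \<inter> dihedral_reflections"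
    by (rule *, simp add: dihedral_translations_def dihedral_reflections_def)+
  moreover have "S = (S \<inter> dihedral_translations) \<union> (S \<inter> dihedral_reflections)"
    using assms by (auto simp: dihedral_translations_def dihedral_reflections_def D_inf_def)
  ultimately show ?thesis by (simp only: dihedral_set_def)
qed

lemma inj_on_fst_dihedral: "inj_on fst dihedral_translations" "inj_on fst dihedral_reflections"
  by (auto simp: inj_on_def dihedral_translations_def dihedral_reflections_def)

lemma gamma_refl_le:
  assumes "1 \<le> p" "p \<le> k"
  shows "gamma_refl k p n \<le> coord_count (k - p) (p - 1) n"
  unfolding gamma_refl_def
proof (rule Max.boundedI)
  fix x assume "x \<in> {card (set_power D_inf S n) | S. S \<subseteq> carrier D_inf \<and> finite S \<and>
            card (S \<inter> dihedral_reflections) = p \<and> card (S \<inter> dihedral_translations) = k - p}"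
  then obtain S where S: "x = card (set_power D_inf S n)" "S \<subseteq> carrier D_inf" "finite S"
    "card (S \<inter> dihedral_reflections) = p" "card (S \<inter> dihedral_translations) = k - p" by blast
  define T R where "T = fst ` (S \<inter> dihedral_translations)" and "R = fst ` (S \<inter> dihedral_reflections)"
  have fin: "finite T" "finite R" using S(3) by (auto simp: T_def R_def)
  have card: "card T = k - p" "card R = p"
    using S(4,5) inj_on_fst_dihedral by (auto simp: T_def R_def card_image inj_on_Int)
  \<comment> \<open>Any reflection may serve as base point; \<open>1 \<le> p\<close> provides
    one.\<close>
  then obtain r0 where r0: "r0 \<in> R" using assms(1) by fastforce
  define D where "D = R - {r0}"
  have D: "finite D" "card D = p - 1" "R = insert r0 D"
    using fin r0 card by (auto simp: D_def)
  have "set_power D_inf S n \<subseteq> dihedral_eval T D r0 n ` coords T D n"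
    using set_power_subset_eval[OF fin(1) D(1), of r0 n] D_inf_subset_split[OF S(2)]
    by (simp add: T_def R_def[symmetric] D(3)[symmetric])
  then have "x \<le> card (coords T D n)"
    unfolding S(1) using finite_coords[OF fin(1) D(1)] by (meson card_image_le card_mono finite_imageI le_trans)
  then show "x \<le> coord_count (k - p) (p - 1) n"
    by (simp add: card_coords fin D card)
qed (rule finite_gamma_refl_set[OF assms(2)] gamma_refl_set_nonempty)+

text \<open>Without reflections there is no base point \<open>r0\<close>; a translation
  \<open>t0\<close> takes its place, leaving \<open>k - 1\<close> free coordinates.\<close>

lemma gamma_refl_0_le:
  assumes "1 \<le> k"
  shows "gamma_refl k 0 n \<le> box_count (k - 1) n 0"
  unfolding gamma_refl_def
proof (rule Max.boundedI)
  fix x assume "x \<in> {card (set_power D_inf S n) | S. S \<subseteq> carrier D_inf \<and> finite S \<and>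
            card (S \<inter> dihedral_reflections) = 0 \<and> card (S \<inter> dihedral_translations) = k - 0}"
  then obtain S where S: "x = card (set_power D_inf S n)" "S \<subseteq> carrier D_inf" "finite S"
    "card (S \<inter> dihedral_reflections) = 0" "card (S \<inter> dihedral_translations) = k" by auto
  define T where "T = fst ` (S \<inter> dihedral_translations)"
  have fin: "finite T" using S(3) by (auto simp: T_def)
  have card: "card T = k"
    using S(5) inj_on_fst_dihedral by (auto simp: T_def card_image inj_on_Int)
  then obtain t0 where t0: "t0 \<in> T" using assms(1) by fastforce
  define D where "D = T - {t0}"
  have D: "finite D" "card D = k - 1" "T = insert t0 D"
    using fin t0 card by (auto simp: D_def)
  have "S \<inter> dihedral_reflections = {}" using S(3,4) by simp
  then have "S = dihedral_set (insert t0 D) {}"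
    using D_inf_subset_split[OF S(2)] by (simp add: T_def[symmetric] D(3)[symmetric])
  then have "set_power D_inf S n \<subseteq> (\<lambda>d. (int n * t0 + (\<Sum>t\<in>D. d t * (t - t0)), 1)) ` mass_box D n 0"
    using set_power_translations_subset[OF D(1)] by simp
  then have "x \<le> card (mass_box D n 0)"
    unfolding S(1) using finite_mass_box[OF D(1)] by (meson card_image_le card_mono finite_imageI le_trans)
  then show "x \<le> box_count (k - 1) n 0"
    by (simp add: card_mass_box D)
qed (rule finite_gamma_refl_set[OF le0] gamma_refl_set_nonempty)+

section \<open>Lower bound from powers of a large base\<close>

text \<open>Uniqueness of expansions with signed digits: the lowest digits differ by a multiple of
  \<open>B\<close> of size at most \<open>2 * M < B\<close>, so they agree and can be stripped
  off.\<close>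

lemma digits_unique:
  fixes f g :: "nat \<Rightarrow> int"
  assumes "\<forall>j. \<bar>f j\<bar> \<le> M" "\<forall>j. \<bar>g j\<bar> \<le> M" "2 * M < B"
    and "(\<Sum>j<K. f j * B ^ j) = (\<Sum>j<K. g j * B ^ j)"
  shows "\<forall>j<K. f j = g j"
  using assms(1,2,4)
proof (induction K arbitrary: f g)
  case (Suc K)
  have split: "(\<Sum>j<Suc K. h j * B ^ j) = h 0 + B * (\<Sum>j<K. h (Suc j) * B ^ j)" for h :: "nat \<Rightarrow> int"
    unfolding sum.lessThan_Suc_shift by (simp add: sum_distrib_left mult_ac)
  define F G where "F = (\<Sum>j<K. f (Suc j) * B ^ j)" and "G = (\<Sum>j<K. g (Suc j) * B ^ j)"
  have eq: "f 0 + B * F = g 0 + B * G"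
    using Suc.prems(3) unfolding split F_def G_def .
  then have "f 0 - g 0 = B * (G - F)"
    by (simp add: right_diff_distrib)
  then have "B dvd f 0 - g 0" by (rule dvdI)
  moreover have M: "\<bar>f 0\<bar> \<le> M" "\<bar>g 0\<bar> \<le> M" using Suc.prems(1,2) by blast+
  ultimately have f0: "f 0 = g 0"
    using dvd_imp_le_int[of "f 0 - g 0" B] assms(3) by linarith
  have "B \<noteq> 0" using M assms(3) by linarith
  then have "F = G" using eq f0 by simp
  then have *: "\<forall>j<K. f (Suc j) = g (Suc j)"
    unfolding F_def G_def
    by (rule Suc.IH[of "\<lambda>j. f (Suc j)" "\<lambda>j. g (Suc j)", rotated -1])
      (simp_all add: Suc.prems(1,2)[rule_format])
  show ?case
  proof (intro allI impI)
    fix j assume "j < Suc K"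
    then show "f j = g j" using f0 * by (cases j) simp_all
  qed
qed simp

lemma abs_le_of_coords:
  assumes "finite T" "finite D" "(c, d) \<in> coords T D n"
  shows "\<bar>c x\<bar> \<le> int n" "\<bar>d x\<bar> \<le> int n"
proof -
  have c: "c \<in> supported_on T" "l1_norm T c \<le> n" "d \<in> supported_on D"
    "pos_mass D d \<le> (n - l1_norm T c + 1) div 2" "neg_mass D d \<le> (n - l1_norm T c) div 2"
    using assms(3) by (simp_all add: coords_def mass_box_def)
  show "\<bar>c x\<bar> \<le> int n"
  proof (cases "x \<in> T")
    case True
    then have "nat \<bar>c x\<bar> \<le> l1_norm T c" using assms(1) unfolding l1_norm_def by (intro member_le_sum) auto
    then show ?thesis using c(2) by linarith
  qed (use c(1) in \<open>auto simp: supported_on_def\<close>)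
  show "\<bar>d x\<bar> \<le> int n"
  proof (cases "x \<in> D")
    case True
    then have "nat (d x) \<le> pos_mass D d" "nat (- d x) \<le> neg_mass D d"
      using member_le_sum[of x D "\<lambda>x. nat (d x)"] member_le_sum[of x D "\<lambda>x. nat (- d x)"] assms(2)
      unfolding pos_mass_def neg_mass_def by blast+
    moreover have "pos_mass D d \<le> n" "neg_mass D d \<le> n" using c(4,5) by linarith+
    ultimately show ?thesis by linarith
  qed (use c(3) in \<open>auto simp: supported_on_def\<close>)
qed

text \<open>With base point 0 the shift by \<open>r0\<close> and the parity term disappear. The
  first component is then a base-\<open>B\<close> expansion with digits of size at most
  \<open>n\<close>, with \<open>c\<close> at the low and \<open>d\<close> at the high
  positions.\<close>

lemma inj_on_dihedral_eval_powers:
  fixes B :: int and q m :: nat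
  assumes "2 * int n < B" "1 < B"
  defines "T \<equiv> (\<lambda>j. B ^ j) ` {..<q}" and "D \<equiv> (\<lambda>j. B ^ j) ` {q..<q + m}"
  shows "inj_on (dihedral_eval T D 0 n) (coords T D n)"
proof (rule inj_onI, clarify)
  fix c d c' d' assume cd: "(c, d) \<in> coords T D n" "(c', d') \<in> coords T D n"
    "dihedral_eval T D 0 n (c, d) = dihedral_eval T D 0 n (c', d')"
  have fin: "finite T" "finite D" by (auto simp: T_def D_def)
  have inj: "inj_on (\<lambda>j. B ^ j) A" for A using assms(2) by (auto simp: inj_on_def)
  have digits: "(\<Sum>t\<in>T. f t * t) + (\<Sum>r\<in>D. g r * r) =
      (\<Sum>j<q + m. (if j < q then f (B ^ j) else g (B ^ j)) * B ^ j)" for f g :: "int \<Rightarrow> int"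
  proof -
    have "{..<q + m} = {..<q} \<union> {q..<q + m}" by auto
    then have "(\<Sum>j<q + m. (if j < q then f (B ^ j) else g (B ^ j)) * B ^ j) =
      (\<Sum>j<q. (if j < q then f (B ^ j) else g (B ^ j)) * B ^ j) +
      (\<Sum>j=q..<q + m. (if j < q then f (B ^ j) else g (B ^ j)) * B ^ j)"
      by (simp add: sum.union_disjoint ivl_disj_int)
    then show ?thesis by (simp add: T_def D_def sum.reindex[OF inj])
  qed
  have "(\<Sum>j<q + m. (if j < q then c (B ^ j) else d (B ^ j)) * B ^ j) =
      (\<Sum>j<q + m. (if j < q then c' (B ^ j) else d' (B ^ j)) * B ^ j)"
    using cd(3) unfolding digits[symmetric] by (simp add: dihedral_eval_def)
  then have *: "\<forall>j<q + m. (if j < q then c (B ^ j) else d (B ^ j)) = (if j < q then c' (B ^ j) else d' (B ^ j))"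
    using abs_le_of_coords[OF fin cd(1)] abs_le_of_coords[OF fin cd(2)] assms(1)
    by (intro digits_unique[of _ "int n"]) auto
  have "c x = c' x" for x
  proof (cases "x \<in> T")
    case True
    then obtain j where "j < q" "x = B ^ j" by (auto simp: T_def)
    then show ?thesis using *[rule_format, of j] by simp
  qed (use cd in \<open>auto simp: coords_def supported_on_def\<close>)
  moreover have "d x = d' x" for x
  proof (cases "x \<in> D")
    case True
    then obtain j where "q \<le> j" "j < q + m" "x = B ^ j" by (auto simp: D_def)
    then show ?thesis using *[rule_format, of j] by simp
  qed (use cd in \<open>auto simp: coords_def mass_box_def supported_on_def\<close>)
  ultimately show "c = c' \<and> d = d'" by blast
qed

lemma gamma_refl_ge:
  assumes "1 \<le> p" "p \<le> k"
  shows "coord_count (k - p) (p - 1) n \<le> gamma_refl k p (n + 2)"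
proof -
  \<comment> \<open>The set may depend on \<open>n\<close>, since the maximum is taken for each
    \<open>n\<close> separately. The summand 2 ensures \<open>1 < B\<close> also for
    \<open>n = 0\<close>.\<close>
  define B where "B = 2 * int n + 2"
  define T where "T = (\<lambda>j. B ^ j) ` {..<k - p}"
  define D where "D = (\<lambda>j. B ^ j) ` {k - p..<k - p + (p - 1)}"
  let ?S = "dihedral_set T (insert 0 D)"
  have B: "2 * int n < B" "1 < B" by (simp_all add: B_def)
  have fin: "finite T" "finite D" by (auto simp: T_def D_def)
  have inj: "inj_on (\<lambda>j. B ^ j) A" for A using B by (auto simp: inj_on_def)
  have card: "card T = k - p" "card D = p - 1" by (simp_all add: T_def D_def card_image inj)
  have 0: "0 \<notin> D" by (auto simp: D_def B_def)
  have S: "?S \<inter> dihedral_reflections = (\<lambda>r. (r, -1)) ` insert 0 D"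
    "?S \<inter> dihedral_translations = (\<lambda>t. (t, 1)) ` T" "?S \<subseteq> carrier D_inf"
    by (auto simp: dihedral_set_def dihedral_reflections_def dihedral_translations_def D_inf_def)
  have S_card: "card (?S \<inter> dihedral_reflections) = p" "card (?S \<inter> dihedral_translations) = k - p"
    unfolding S using assms fin 0 card by (simp_all add: card_image inj_on_def del: image_insert)
  have "finite ?S" using fin by (simp add: dihedral_set_def)
  have "coord_count (k - p) (p - 1) n = card (dihedral_eval T D 0 n ` coords T D n)"
    using card_image[OF inj_on_dihedral_eval_powers[OF B, of "k - p" "p - 1", folded T_def D_def]]
    by (simp add: card_coords fin card)
  also have "finite (set_power D_inf ?S (n + 2))"
    using set_power_subset_eval[OF fin, of 0 "n + 2"] finite_coords[OF fin] by (meson finite_imageI finite_subset)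
  then have "card (dihedral_eval T D 0 n ` coords T D n) \<le> card (set_power D_inf ?S (n + 2))"
    using eval_image_subset_set_power[OF fin] by (rule card_mono)
  also have "\<dots> \<le> gamma_refl k p (n + 2)"
    unfolding gamma_refl_def
    using finite_gamma_refl_set[OF assms(2)] S S_card \<open>finite ?S\<close> by (intro Max_ge) blast+
  finally show ?thesis .
qed

subsection \<open>Leading-order asymptotics\<close>

text \<open>The bound holds for every \<open>n\<close>, including 0, so it can be summed and
  shifted. The factor \<open>real m\<close> forces equality in degree 0, where the truncated
  exponent \<open>m - 1\<close> would allow a constant error.\<close>

definition poly_asymp :: "nat \<Rightarrow> real \<Rightarrow> (nat \<Rightarrow> real) \<Rightarrow> bool" where
  "poly_asymp m C f \<longleftrightarrow>
     (\<exists>K\<ge>0. \<forall>n. \<bar>f n - C * real n ^ m\<bar> \<le> K * real m * (real n + 1) ^ (m - 1))"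

lemma poly_asympI:
  assumes "\<And>n. \<bar>f n - C * real n ^ m\<bar> \<le> K * real m * (real n + 1) ^ (m - 1)" "K \<ge> 0"
  shows "poly_asymp m C f"
  using assms unfolding poly_asymp_def by blast

lemma poly_asympE:
  assumes "poly_asymp m C f"
  obtains K where "K \<ge> 0" "\<And>n. \<bar>f n - C * real n ^ m\<bar> \<le> K * real m * (real n + 1) ^ (m - 1)"
  using assms unfolding poly_asymp_def by blast

lemma poly_asymp_const: "poly_asymp 0 C (\<lambda>_. C)"
  by (rule poly_asympI[of _ _ _ 0]) simp_all

lemma poly_asymp_add:
  assumes "poly_asymp m C f" "poly_asymp m C' g"
  shows "poly_asymp m (C + C') (\<lambda>n. f n + g n)"
proof -
  from assms(1) obtain K where K: "K \<ge> 0" "\<And>n. \<bar>f n - C * real n ^ m\<bar> \<le> K * real m * (real n + 1) ^ (m - 1)"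
    by (rule poly_asympE) blast
  from assms(2) obtain K' where K': "K' \<ge> 0" "\<And>n. \<bar>g n - C' * real n ^ m\<bar> \<le> K' * real m * (real n + 1) ^ (m - 1)"
    by (rule poly_asympE) blast
  show ?thesis
  proof (rule poly_asympI)
    fix n
    have "\<bar>(f n + g n) - (C + C') * real n ^ m\<bar> \<le> \<bar>f n - C * real n ^ m\<bar> + \<bar>g n - C' * real n ^ m\<bar>"
      by (simp add: distrib_right)
    also have "\<dots> \<le> (K + K') * real m * (real n + 1) ^ (m - 1)"
      using K(2)[of n] K'(2)[of n] by (simp add: distrib_right)
    finally show "\<bar>(f n + g n) - (C + C') * real n ^ m\<bar> \<le> (K + K') * real m * (real n + 1) ^ (m - 1)" .
  qed (use K(1) K'(1) in simp)
qed

lemma poly_asymp_bound: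
  assumes "poly_asymp m C f"
  obtains K where "K \<ge> 0" "\<And>n. \<bar>f n\<bar> \<le> K * (real n + 1) ^ m"
proof -
  from assms obtain K where K: "K \<ge> 0" "\<And>n. \<bar>f n - C * real n ^ m\<bar> \<le> K * real m * (real n + 1) ^ (m - 1)"
    by (rule poly_asympE) blast
  have "\<bar>f n\<bar> \<le> (K * real m + \<bar>C\<bar>) * (real n + 1) ^ m" for n
  proof -
    have "\<bar>f n\<bar> \<le> \<bar>f n - C * real n ^ m\<bar> + \<bar>C * real n ^ m\<bar>" by linarith
    also have "\<bar>f n - C * real n ^ m\<bar> \<le> K * real m * (real n + 1) ^ (m - 1)" by (rule K(2))
    also have "\<dots> \<le> K * real m * (real n + 1) ^ m"
      using K(1) by (intro mult_left_mono power_increasing) auto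
    also have "\<bar>C * real n ^ m\<bar> \<le> \<bar>C\<bar> * (real n + 1) ^ m"
      unfolding abs_mult by (intro mult_left_mono) (auto intro: power_mono)
    finally show ?thesis by (simp add: distrib_right)
  qed
  then show ?thesis using that[of "K * real m + \<bar>C\<bar>"] K(1) by simp
qed

text \<open>The error is \<open>f n * (g n - C' * n ^ b) + (f n - C * n ^ a) * (C' * n ^ b)\<close>,
  where each summand pairs a growth bound with one error bound.\<close>

lemma poly_asymp_mult:
  assumes "poly_asymp a C f" "poly_asymp b C' g"
  shows "poly_asymp (a + b) (C * C') (\<lambda>n. f n * g n)"
proof -
  from assms(1) obtain K where K: "K \<ge> 0" "\<And>n. \<bar>f n - C * real n ^ a\<bar> \<le> K * real a * (real n + 1) ^ (a - 1)"
    by (rule poly_asympE) blast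
  from assms(2) obtain K' where K': "K' \<ge> 0" "\<And>n. \<bar>g n - C' * real n ^ b\<bar> \<le> K' * real b * (real n + 1) ^ (b - 1)"
    by (rule poly_asympE) blast
  from assms(1) obtain M where M: "M \<ge> 0" "\<And>n. \<bar>f n\<bar> \<le> M * (real n + 1) ^ a"
    by (rule poly_asymp_bound) blast
  let ?L = "M * K' + K * \<bar>C'\<bar>"
  show ?thesis
  proof (rule poly_asympI[of _ _ _ ?L])
    fix n
    let ?x = "real n + 1"
    \<comment> \<open>Where an exponent \<open>a - 1\<close> or \<open>b - 1\<close> is truncated,
      the factor \<open>real a\<close> or \<open>real b\<close> is 0.\<close>
    have pow: "real b * (?x ^ a * ?x ^ (b - 1)) = real b * ?x ^ (a + b - 1)"
      "real a * (?x ^ (a - 1) * ?x ^ b) = real a * ?x ^ (a + b - 1)"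
      by (cases a; cases b; simp add: power_add)+
    have "f n * g n - C * C' * real n ^ (a + b) =
        f n * (g n - C' * real n ^ b) + (f n - C * real n ^ a) * (C' * real n ^ b)"
      by (simp add: algebra_simps power_add)
    then have "\<bar>f n * g n - C * C' * real n ^ (a + b)\<bar> \<le>
        \<bar>f n\<bar> * \<bar>g n - C' * real n ^ b\<bar> + \<bar>f n - C * real n ^ a\<bar> * (\<bar>C'\<bar> * real n ^ b)"
      by (metis abs_mult abs_of_nat abs_triangle_ineq power_abs)
    also have "\<dots> \<le> (M * ?x ^ a) * (K' * real b * ?x ^ (b - 1)) + (K * real a * ?x ^ (a - 1)) * (\<bar>C'\<bar> * ?x ^ b)"
      using K K' M by (intro add_mono mult_mono power_mono) auto
    also have "\<dots> = M * K' * (real b * (?x ^ a * ?x ^ (b - 1))) + K * \<bar>C'\<bar> * (real a * (?x ^ (a - 1) * ?x ^ b))"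
      by (simp add: mult_ac)
    also have "\<dots> = M * K' * (real b * ?x ^ (a + b - 1)) + K * \<bar>C'\<bar> * (real a * ?x ^ (a + b - 1))"
      by (simp only: pow)
    also have "\<dots> \<le> M * K' * (real (a + b) * ?x ^ (a + b - 1)) + K * \<bar>C'\<bar> * (real (a + b) * ?x ^ (a + b - 1))"
      using K K' M by (intro add_mono mult_left_mono mult_right_mono) auto
    finally show "\<bar>f n * g n - C * C' * real n ^ (a + b)\<bar> \<le> ?L * real (a + b) * ?x ^ (a + b - 1)"
      by (simp add: algebra_simps)
  qed (use K K' M in simp)
qed

lemma poly_asymp_cmult: "poly_asymp m C f \<Longrightarrow> poly_asymp m (c * C) (\<lambda>n. c * f n)"
  using poly_asymp_mult[OF poly_asymp_const[of c]] by simp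

lemma poly_asymp_sum:
  assumes "finite A" "\<And>a. a \<in> A \<Longrightarrow> poly_asymp m (C a) (f a)"
  shows "poly_asymp m (\<Sum>a\<in>A. C a) (\<lambda>n. \<Sum>a\<in>A. f a n)"
  using assms
proof (induction A rule: finite_induct)
  case empty
  show ?case by (rule poly_asympI[of _ _ _ 0]) simp_all
qed (simp add: poly_asymp_add)

lemma poly_asymp_prod:
  fixes a :: nat
  assumes "\<And>i. i < a \<Longrightarrow> poly_asymp 1 C (f i)"
  shows "poly_asymp a (C ^ a) (\<lambda>n. \<Prod>i<a. f i n)"
  using assms
proof (induction a)
  case 0
  show ?case using poly_asymp_const[of 1] by simp
next
  case (Suc a)
  then show ?case
    using poly_asymp_mult[of a "C ^ a" "\<lambda>n. \<Prod>i<a. f i n" 1 C "f a"] by (simp add: mult.commute)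
qed

lemma poly_asymp_affine:
  assumes "\<And>n. \<bar>f n - C * real n\<bar> \<le> K"
  shows "poly_asymp 1 C f"
  using assms order_trans[OF abs_ge_zero assms] by (intro poly_asympI[of _ _ _ K]) simp_all

text \<open>The coefficient is \<open>1 / fact a\<close> times a product of \<open>a\<close> factors
  of slope \<open>C\<close>; for \<open>h n < a\<close> one factor is 0, so the product formula
  still holds.\<close>

lemma poly_asymp_choose:
  assumes "\<And>n. \<bar>real (h n) - C * real n\<bar> \<le> K"
  shows "poly_asymp a (C ^ a / fact a) (\<lambda>n. real (h n choose a))"
proof -
  have "poly_asymp 1 C (\<lambda>n. real (h n) - real i)" for i
    by (rule poly_asymp_affine[of _ _ "K + real i"]) (use assms in \<open>smt (verit) of_nat_0_le_iff\<close>)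
  then have "poly_asymp a (C ^ a) (\<lambda>n. \<Prod>i<a. real (h n) - real i)"
    by (rule poly_asymp_prod)
  then have "poly_asymp a (1 / fact a * C ^ a) (\<lambda>n. 1 / fact a * (\<Prod>i<a. real (h n) - real i))"
    by (rule poly_asymp_cmult)
  moreover have "1 / fact a * (\<Prod>i<a. real x - real i) = real (x choose a)" for x
    unfolding binomial_gbinomial gbinomial_prod_rev by (simp add: atLeast0LessThan)
  ultimately show ?thesis by simp
qed

section \<open>Power sums and shifts of the argument\<close>

lemma power_diff_le:
  fixes x y :: real
  assumes "0 \<le> y" "y \<le> x"
  shows "x ^ m - y ^ m \<le> real m * (x - y) * x ^ (m - 1)"
proof (induction m)
  case (Suc m)
  have "x ^ Suc m - y ^ Suc m = x * (x ^ m - y ^ m) + (x - y) * y ^ m"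
    by (simp add: algebra_simps)
  also have "\<dots> \<le> x * (real m * (x - y) * x ^ (m - 1)) + (x - y) * x ^ m"
    using Suc assms by (intro add_mono mult_left_mono power_mono) auto
  also have "\<dots> = real (Suc m) * (x - y) * x ^ (Suc m - 1)"
    by (cases m) (simp_all add: algebra_simps)
  finally show ?case .
qed simp

lemma power_diff_ge:
  fixes x y :: real
  assumes "0 \<le> y" "y \<le> x"
  shows "real m * (x - y) * y ^ (m - 1) \<le> x ^ m - y ^ m"
proof (induction m)
  case (Suc m)
  have "real (Suc m) * (x - y) * y ^ (Suc m - 1) = y * (real m * (x - y) * y ^ (m - 1)) + (x - y) * y ^ m"
    by (cases m) (simp_all add: algebra_simps)
  also have "\<dots> \<le> y * (x ^ m - y ^ m) + (x - y) * x ^ m"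
    using Suc assms by (intro add_mono mult_left_mono power_mono) auto
  also have "\<dots> = x ^ Suc m - y ^ Suc m"
    by (simp add: algebra_simps)
  finally show ?case .
qed simp

text \<open>Telescoping the differences of consecutive powers of exponent \<open>Suc m\<close>, each
  bounded by the mean value inequalities above. The extra \<open>real n ^ m\<close> completes the
  sum to \<open>i \<le> n\<close>.\<close>

lemma sum_powers_bounds:
  "real (Suc m) * (\<Sum>i<n. real i ^ m) \<le> real n ^ Suc m"
  "real n ^ Suc m \<le> real (Suc m) * (\<Sum>i<n. real i ^ m) + real (Suc m) * real n ^ m"
proof -
  show "real (Suc m) * (\<Sum>i<n. real i ^ m) \<le> real n ^ Suc m"
  proof (induction n)
    case (Suc n)
    then show ?case
      using power_diff_ge[of "real n" "real (Suc n)" "Suc m"] by (simp add: distrib_left del: power_Suc)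
  qed simp
  show "real n ^ Suc m \<le> real (Suc m) * (\<Sum>i<n. real i ^ m) + real (Suc m) * real n ^ m"
  proof (induction n)
    case (Suc n)
    then show ?case
      using power_diff_le[of "real n" "real (Suc n)" "Suc m"] by (simp add: distrib_left del: power_Suc)
  qed simp
qed

text \<open>Two errors add up: the \<open>n\<close> individual errors, and the distance of the power
  sum from \<open>n ^ Suc m / Suc m\<close>.\<close>

lemma poly_asymp_sum_lessThan:
  assumes "poly_asymp m C f"
  shows "poly_asymp (Suc m) (C / real (Suc m)) (\<lambda>n. \<Sum>i<n. f i)"
proof -
  from assms obtain K where K: "K \<ge> 0" "\<And>n. \<bar>f n - C * real n ^ m\<bar> \<le> K * real m * (real n + 1) ^ (m - 1)"
    by (rule poly_asympE) blast
  show ?thesis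
  proof (rule poly_asympI[of _ _ _ "K * real m + \<bar>C\<bar>"])
    fix n
    have "\<bar>(\<Sum>i<n. f i) - C * (\<Sum>i<n. real i ^ m)\<bar> \<le> K * real m * (real n + 1) ^ m"
    proof -
      have "\<bar>(\<Sum>i<n. f i) - C * (\<Sum>i<n. real i ^ m)\<bar> = \<bar>\<Sum>i<n. f i - C * real i ^ m\<bar>"
        by (simp add: sum_subtractf sum_distrib_left)
      also have "\<dots> \<le> (\<Sum>i<n. \<bar>f i - C * real i ^ m\<bar>)" by (rule sum_abs)
      also have "\<dots> \<le> (\<Sum>i<n. K * real m * (real n + 1) ^ (m - 1))"
        using K(1) by (intro sum_mono order_trans[OF K(2)] mult_left_mono power_mono) auto
      also have "\<dots> = K * real m * (real n * (real n + 1) ^ (m - 1))" by simp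
      also have "\<dots> \<le> K * real m * (real n + 1) ^ m"
      proof (cases m)
        case (Suc l)
        then show ?thesis using K(1) by (intro mult_left_mono) (auto intro: mult_right_mono)
      qed simp
      finally show ?thesis .
    qed
    moreover have "\<bar>C * (\<Sum>i<n. real i ^ m) - C / real (Suc m) * real n ^ Suc m\<bar> \<le> \<bar>C\<bar> * (real n + 1) ^ m"
    proof -
      have "C * (\<Sum>i<n. real i ^ m) - C / real (Suc m) * real n ^ Suc m =
        C * ((\<Sum>i<n. real i ^ m) - real n ^ Suc m / real (Suc m))"
        by (simp add: right_diff_distrib)
      moreover have "\<bar>(\<Sum>i<n. real i ^ m) - real n ^ Suc m / real (Suc m)\<bar> \<le> real n ^ m"
      proof -
        have "(\<Sum>i<n. real i ^ m) \<le> real n ^ Suc m / real (Suc m)"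
          using sum_powers_bounds(1)[of m n] by (simp add: pos_le_divide_eq mult.commute)
        moreover have "real n ^ Suc m / real (Suc m) \<le> (\<Sum>i<n. real i ^ m) + real n ^ m"
          using sum_powers_bounds(2)[of n m] by (simp add: pos_divide_le_eq algebra_simps)
        ultimately show ?thesis by linarith
      qed
      moreover have "real n ^ m \<le> (real n + 1) ^ m" by (intro power_mono) auto
      ultimately show ?thesis by (simp only: abs_mult) (intro mult_left_mono, auto)
    qed
    ultimately have "\<bar>(\<Sum>i<n. f i) - C / real (Suc m) * real n ^ Suc m\<bar> \<le> (K * real m + \<bar>C\<bar>) * (real n + 1) ^ m"
      by (simp only: distrib_right)
    also have "\<dots> \<le> (K * real m + \<bar>C\<bar>) * real (Suc m) * (real n + 1) ^ (Suc m - 1)"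
      using K(1) mult_left_mono[of 1 "real (Suc m)" "(K * real m + \<bar>C\<bar>) * (real n + 1) ^ m"]
      by (simp add: mult_ac)
    finally show "\<bar>(\<Sum>i<n. f i) - C / real (Suc m) * real n ^ Suc m\<bar>
        \<le> (K * real m + \<bar>C\<bar>) * real (Suc m) * (real n + 1) ^ (Suc m - 1)" .
  qed (use K(1) in simp)
qed

lemma poly_asymp_raise:
  assumes "poly_asymp m C f"
  shows "poly_asymp (Suc m) 0 f"
proof -
  from assms obtain K where K: "K \<ge> 0" "\<And>n. \<bar>f n\<bar> \<le> K * (real n + 1) ^ m"
    by (rule poly_asymp_bound) blast
  show ?thesis
  proof (rule poly_asympI[of _ _ _ K])
    fix n
    have "K * (real n + 1) ^ m \<le> K * (real n + 1) ^ m * real (Suc m)"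
      using K(1) mult_left_mono[of 1 "real (Suc m)" "K * (real n + 1) ^ m"] by simp
    with K(2)[of n] show "\<bar>f n - 0 * real n ^ Suc m\<bar> \<le> K * real (Suc m) * (real n + 1) ^ (Suc m - 1)"
      by (simp add: mult_ac)
  qed (rule K(1))
qed

text \<open>Truncated subtraction moves the argument by at most \<open>j\<close>, which costs one
  degree by \<open>power_diff_le\<close>.\<close>

lemma poly_asymp_shift:
  assumes "poly_asymp m C f"
  shows "poly_asymp m C (\<lambda>n. f (n - j))"
proof -
  from assms obtain K where K: "K \<ge> 0" "\<And>n. \<bar>f n - C * real n ^ m\<bar> \<le> K * real m * (real n + 1) ^ (m - 1)"
    by (rule poly_asympE) blast
  show ?thesis
  proof (rule poly_asympI[of _ _ _ "K + \<bar>C\<bar> * real j"])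
    fix n
    have "\<bar>f (n - j) - C * real n ^ m\<bar> \<le> \<bar>f (n - j) - C * real (n - j) ^ m\<bar> + \<bar>C\<bar> * (real n ^ m - real (n - j) ^ m)"
    proof -
      have "real (n - j) ^ m \<le> real n ^ m" by (intro power_mono) auto
      then have "\<bar>C * (real n ^ m - real (n - j) ^ m)\<bar> = \<bar>C\<bar> * (real n ^ m - real (n - j) ^ m)"
        by (simp add: abs_mult)
      moreover have "f (n - j) - C * real n ^ m = f (n - j) - C * real (n - j) ^ m - C * (real n ^ m - real (n - j) ^ m)"
        by (simp add: right_diff_distrib)
      ultimately show ?thesis by linarith
    qed
    also have "\<bar>f (n - j) - C * real (n - j) ^ m\<bar> \<le> K * real m * (real n + 1) ^ (m - 1)"
      using K(1) by (intro order_trans[OF K(2)] mult_left_mono power_mono) auto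
    also have "\<bar>C\<bar> * (real n ^ m - real (n - j) ^ m) \<le> \<bar>C\<bar> * (real m * real j * (real n + 1) ^ (m - 1))"
    proof (rule mult_left_mono)
      have "real n ^ m - real (n - j) ^ m \<le> real m * (real n - real (n - j)) * real n ^ (m - 1)"
        by (rule power_diff_le) auto
      also have "\<dots> \<le> real m * real j * (real n + 1) ^ (m - 1)"
        by (intro mult_mono power_mono) auto
      finally show "real n ^ m - real (n - j) ^ m \<le> real m * real j * (real n + 1) ^ (m - 1)" .
    qed simp
    finally show "\<bar>f (n - j) - C * real n ^ m\<bar> \<le> (K + \<bar>C\<bar> * real j) * real m * (real n + 1) ^ (m - 1)"
      by (simp add: algebra_simps)
  qed (use K(1) in simp)
qed

text \<open>For \<open>m = 0\<close> the exponent is -1, and the claim rests on the exactness that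
  \<open>poly_asymp\<close> has in degree 0.\<close>

lemma poly_asymp_imp_bigo:
  assumes "poly_asymp m C f"
  shows "(\<lambda>n. f n - C * real n ^ m) \<in> O(\<lambda>n. real n powi (int m - 1))"
proof -
  from assms obtain K where K: "K \<ge> 0" "\<And>n. \<bar>f n - C * real n ^ m\<bar> \<le> K * real m * (real n + 1) ^ (m - 1)"
    by (rule poly_asympE) blast
  show ?thesis
  proof (cases m)
    case 0
    then have "f n - C * real n ^ m = 0" for n using K(2)[of n] by simp
    then show ?thesis by simp
  next
    case (Suc l)
    show ?thesis
    proof (rule bigoI[of _ "K * real m * 2 ^ l"], rule eventually_sequentiallyI[of 1])
      fix n :: nat assume "1 \<le> n"
      then have "(real n + 1) ^ l \<le> (2 * real n) ^ l" by (intro power_mono) auto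
      then have "K * real m * (real n + 1) ^ l \<le> K * real m * (2 * real n) ^ l"
        using K(1) by (intro mult_left_mono) auto
      moreover have "real n powi (int m - 1) = real n ^ l"
        using Suc by simp
      ultimately show "norm (f n - C * real n ^ m) \<le> K * real m * 2 ^ l * norm (real n powi (int m - 1))"
        using K(2)[of n] Suc by (simp add: power_mult_distrib mult_ac del: of_nat_Suc)
    qed
  qed
qed

lemma poly_asymp_tendsto:
  assumes "poly_asymp m C f"
  shows "(\<lambda>n. f n / real n ^ m) \<longlonglongrightarrow> C"
proof -
  from assms obtain K where K: "K \<ge> 0" "\<And>n. \<bar>f n - C * real n ^ m\<bar> \<le> K * real m * (real n + 1) ^ (m - 1)"
    by (rule poly_asympE) blast
  have "(\<lambda>n. f n / real n ^ m - C) \<longlonglongrightarrow> 0"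
  proof (rule Lim_null_comparison)
    show "\<forall>\<^sub>F n in sequentially. norm (f n / real n ^ m - C) \<le> K * real m * 2 ^ (m - 1) * (1 / real n)"
    proof (rule eventually_sequentiallyI[of 1])
      fix n :: nat assume n: "1 \<le> n"
      have "f n / real n ^ m - C = (f n - C * real n ^ m) / real n ^ m"
        using n by (simp add: field_simps)
      then have "norm (f n / real n ^ m - C) = \<bar>f n - C * real n ^ m\<bar> / real n ^ m"
        by simp
      also have "\<dots> \<le> K * real m * (real n + 1) ^ (m - 1) / real n ^ m"
        by (intro divide_right_mono K) auto
      also have "\<dots> \<le> K * real m * (2 * real n) ^ (m - 1) / real n ^ m"
        using K(1) n by (intro divide_right_mono mult_left_mono power_mono) auto
      also have "\<dots> = K * real m * 2 ^ (m - 1) * (1 / real n)"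
        using n by (cases m) (simp_all add: power_mult_distrib)
      finally show "norm (f n / real n ^ m - C) \<le> K * real m * 2 ^ (m - 1) * (1 / real n)" .
    qed
    show "(\<lambda>n. K * real m * 2 ^ (m - 1) * (1 / real n)) \<longlonglongrightarrow> 0"
      by (rule tendsto_mult_right_zero[OF lim_1_over_n])
  qed
  then show ?thesis by (simp add: LIM_zero_iff)
qed

lemma poly_asymp_eventually_less:
  assumes "poly_asymp m C f" "poly_asymp m C' g" "C < C'"
  shows "\<forall>\<^sub>F n in sequentially. f n < g n"
proof -
  obtain c where c: "C < c" "c < C'" using dense[OF assms(3)] by blast
  have "\<forall>\<^sub>F n in sequentially. f n / real n ^ m < c" "\<forall>\<^sub>F n in sequentially. c < g n / real n ^ m"
    using order_tendstoD[OF poly_asymp_tendsto[OF assms(1)]]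
      order_tendstoD[OF poly_asymp_tendsto[OF assms(2)]] c by auto
  then show ?thesis
    using eventually_gt_at_top[of 0]
  proof eventually_elim
    case (elim n)
    then have "f n / real n ^ m < g n / real n ^ m" by linarith
    then show ?case using elim(3) by (simp add: divide_less_cancel)
  qed
qed

lemma bigo_sandwich:
  fixes f g h c :: "nat \<Rightarrow> real"
  assumes "(\<lambda>n. f n - c n) \<in> O(e)" "(\<lambda>n. h n - c n) \<in> O(e)"
    and "\<forall>\<^sub>F n in sequentially. f n \<le> g n" "\<forall>\<^sub>F n in sequentially. g n \<le> h n"
  shows "(\<lambda>n. g n - c n) \<in> O(e)"
proof -
  have "(\<lambda>n. \<bar>f n - c n\<bar> + \<bar>h n - c n\<bar>) \<in> O(e)"
    using assms(1,2) by (intro sum_in_bigo) simp_all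
  moreover have "(\<lambda>n. g n - c n) \<in> O(\<lambda>n. \<bar>f n - c n\<bar> + \<bar>h n - c n\<bar>)"
  proof (rule bigoI[of _ 1])
    show "\<forall>\<^sub>F n in sequentially. norm (g n - c n) \<le> 1 * norm (\<bar>f n - c n\<bar> + \<bar>h n - c n\<bar>)"
      using assms(3,4) by eventually_elim auto
  qed
  ultimately show ?thesis by (rule landau_o.big_trans[rotated])
qed

section \<open>Leading coefficients of the counts\<close>

text \<open>The slopes of the two budgets are kept separate: both are 1/2 in the presence of
  reflections, while sets of translations need 1 and 0.\<close>

lemma poly_asymp_box_count:
  assumes "\<And>n. \<bar>real (x n) - C * real n\<bar> \<le> K" "\<And>n. \<bar>real (y n) - C' * real n\<bar> \<le> K'"
  shows "poly_asymp m (\<Sum>a\<le>m. real (m choose a) * (C ^ a / fact a) * (C' ^ (m - a) / fact (m - a)))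
    (\<lambda>n. real (box_count m (x n) (y n)))"
proof -
  have "poly_asymp m (real (m choose a) * (C ^ a / fact a) * (C' ^ (m - a) / fact (m - a)))
      (\<lambda>n. real (m choose a) * real (x n choose a) * real (y n + (m - a) choose (m - a)))" if "a \<le> m" for a
  proof -
    have "poly_asymp (m - a) (C' ^ (m - a) / fact (m - a)) (\<lambda>n. real (y n + (m - a) choose (m - a)))"
    proof (rule poly_asymp_choose)
      show "\<bar>real (y n + (m - a)) - C' * real n\<bar> \<le> K' + real (m - a)" for n
        using assms(2)[of n] by (simp only: of_nat_add)
    qed
    from poly_asymp_mult[OF poly_asymp_cmult[OF poly_asymp_choose[OF assms(1), of a], of "real (m choose a)"] this]
    show ?thesis using that by (simp only: le_add_diff_inverse)
  qed
  then show ?thesis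
    unfolding box_count_def of_nat_sum of_nat_mult by (intro poly_asymp_sum) auto
qed

text \<open>Since \<open>1 / (fact a * fact (m - a))\<close> is
  \<open>(m choose a) / fact m\<close>, the sum of squares of a row of Pascal's triangle
  appears.\<close>

lemma sum_choose_div_fact:
  "(\<Sum>a\<le>m. real (m choose a) * (C ^ a / fact a) * (C ^ (m - a) / fact (m - a))) =
    C ^ m / fact m * real ((2 * m) choose m)"
proof -
  have "real (m choose a) * (C ^ a / fact a) * (C ^ (m - a) / fact (m - a)) =
      C ^ m / fact m * real ((m choose a)\<^sup>2)" if "a \<le> m" for a
    using that by (simp add: binomial_fact[OF that] power2_eq_square field_simps flip: power_add)
  then have "(\<Sum>a\<le>m. real (m choose a) * (C ^ a / fact a) * (C ^ (m - a) / fact (m - a))) =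
      C ^ m / fact m * real (\<Sum>a\<le>m. (m choose a)\<^sup>2)"
    by (simp add: sum_distrib_left)
  then show ?thesis by (simp only: choose_square_sum)
qed

text \<open>In the recursion for a further translation the unsummed term has lower degree, while the
  doubled sum multiplies the leading coefficient by \<open>2 / Suc (q + m)\<close>.\<close>

lemma poly_asymp_coord_count:
  "poly_asymp (q + m) (real ((2 * m) choose m) / 2 ^ (2 * m) * (2 ^ (q + m) / fact (q + m)))
    (\<lambda>n. real (coord_count q m n))"
proof (induction q)
  case 0
  have "poly_asymp m (\<Sum>a\<le>m. real (m choose a) * ((1 / 2) ^ a / fact a) * ((1 / 2) ^ (m - a) / fact (m - a)))
      (\<lambda>n. real (box_count m ((n + 1) div 2) (n div 2)))"
  proof (rule poly_asymp_box_count)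
    fix n :: nat
    have "2 * ((n + 1) div 2) \<le> n + 1" "n \<le> 2 * ((n + 1) div 2)" "2 * (n div 2) \<le> n" "n \<le> 2 * (n div 2) + 1"
      by linarith+
    then have "2 * real ((n + 1) div 2) \<le> real n + 1" "real n \<le> 2 * real ((n + 1) div 2)"
      "2 * real (n div 2) \<le> real n" "real n \<le> 2 * real (n div 2) + 1"
      by linarith+
    then show "\<bar>real ((n + 1) div 2) - 1 / 2 * real n\<bar> \<le> 1" "\<bar>real (n div 2) - 1 / 2 * real n\<bar> \<le> 1"
      by linarith+
  qed
  moreover have "(1 / 2) ^ m / fact m * real ((2 * m) choose m) =
      real ((2 * m) choose m) / 2 ^ (2 * m) * (2 ^ m / fact m)"
    by (simp add: power_divide mult_2 power_add)
  ultimately show ?case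
    by (simp only: sum_choose_div_fact coord_count.simps add_0)
next
  case (Suc q)
  let ?A = "real ((2 * m) choose m) / 2 ^ (2 * m)"
  have "poly_asymp (Suc (q + m)) (0 + 2 * (?A * (2 ^ (q + m) / fact (q + m)) / real (Suc (q + m))))
      (\<lambda>n. real (coord_count q m n) + 2 * (\<Sum>i<n. real (coord_count q m i)))"
    by (intro poly_asymp_add poly_asymp_raise[OF Suc] poly_asymp_cmult poly_asymp_sum_lessThan Suc)
  moreover have "0 + 2 * (?A * (2 ^ (q + m) / fact (q + m)) / real (Suc (q + m))) =
      ?A * (2 ^ (Suc q + m) / fact (Suc q + m))"
    by (simp add: field_simps)
  ultimately show ?case by simp
qed

section \<open>Transfer to the growth functions\<close>

lemma gamma_refl_sandwich:
  assumes "1 \<le> p" "p \<le> k"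
  shows "\<forall>\<^sub>F n in sequentially. real (coord_count (k - p) (p - 1) (n - 2)) \<le> real (gamma_refl k p n)"
    and "\<forall>\<^sub>F n in sequentially. real (gamma_refl k p n) \<le> real (coord_count (k - p) (p - 1) n)"
proof -
  show "\<forall>\<^sub>F n in sequentially. real (coord_count (k - p) (p - 1) (n - 2)) \<le> real (gamma_refl k p n)"
    using eventually_ge_at_top[of 2]
  proof eventually_elim
    case (elim n)
    then show ?case using gamma_refl_ge[OF assms, of "n - 2"] by (simp only: le_add_diff_inverse2 of_nat_le_iff)
  qed
qed (use gamma_refl_le[OF assms] in simp)

lemma poly_asymp_coord_count':
  assumes "1 \<le> p" "p \<le> k"
  shows "poly_asymp (k - 1)
      (real ((2 * p - 2) choose (p - 1)) / 2 ^ (2 * p - 2) * (2 ^ (k - 1) / fact (k - 1)))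
      (\<lambda>n. real (coord_count (k - p) (p - 1) n))"
proof -
  have "k - p + (p - 1) = k - 1" "2 * (p - 1) = 2 * p - 2" using assms by simp_all
  then show ?thesis using poly_asymp_coord_count[of "k - p" "p - 1"] by simp
qed

lemma gamma_refl_bigo:
  assumes "1 \<le> p" "p \<le> k"
  shows "(\<lambda>n. real (gamma_refl k p n)
        - real ((2 * p - 2) choose (p - 1)) / 2 ^ (2 * p - 2)
          * (2 ^ (k - 1) / fact (k - 1)) * real n ^ (k - 1))
      \<in> O(\<lambda>n. real n powi (int k - 2))"
proof (rule bigo_sandwich[OF _ _ gamma_refl_sandwich[OF assms]])
  have "int (k - 1) - 1 = int k - 2" using assms by simp
  then show "(\<lambda>n. real (coord_count (k - p) (p - 1) (n - 2))
        - real ((2 * p - 2) choose (p - 1)) / 2 ^ (2 * p - 2)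
          * (2 ^ (k - 1) / fact (k - 1)) * real n ^ (k - 1))
      \<in> O(\<lambda>n. real n powi (int k - 2))"
    "(\<lambda>n. real (coord_count (k - p) (p - 1) n)
        - real ((2 * p - 2) choose (p - 1)) / 2 ^ (2 * p - 2)
          * (2 ^ (k - 1) / fact (k - 1)) * real n ^ (k - 1))
      \<in> O(\<lambda>n. real n powi (int k - 2))"
    using poly_asymp_imp_bigo[OF poly_asymp_shift[OF poly_asymp_coord_count'[OF assms], of 2]]
      poly_asymp_imp_bigo[OF poly_asymp_coord_count'[OF assms]] by simp_all
qed

text \<open>The row sums to \<open>2 ^ (2 * m)\<close> and contains, besides the central entry, the
  entry 1 at position 0, which is a different position for \<open>m \<ge> 1\<close>.\<close>

lemma central_binomial_less:
  assumes "m \<ge> 1"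
  shows "(2 * m) choose m < 2 ^ (2 * m)"
proof -
  have "((2 * m) choose m) + ((2 * m) choose 0) = (\<Sum>i\<in>{m, 0}. (2 * m) choose i)"
    using assms by simp
  also have "\<dots> \<le> (\<Sum>i\<le>2 * m. (2 * m) choose i)"
    by (intro sum_mono2) auto
  finally show ?thesis by (simp add: choose_row_sum)
qed

text \<open>The upper bound for \<open>p\<close> is compared with the lower bound for one
  reflection, and a smaller leading coefficient decides. Only \<open>p = 0\<close>,
  \<open>k = 1\<close> has equal coefficients; there both bounds are 1.\<close>

lemma gamma_refl_eventually_le:
  assumes "p \<le> k" "1 \<le> k"
  shows "\<forall>\<^sub>F n in sequentially. gamma_refl k p n \<le> gamma_refl k 1 n"
proof -
  let ?C = "2 ^ (k - 1) / fact (k - 1) :: real"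
  have one: "poly_asymp (k - 1) ?C (\<lambda>n. real (coord_count (k - 1) 0 (n - 2)))"
    using poly_asymp_shift[OF poly_asymp_coord_count'[of 1 k], of 2] assms by simp
  have ge: "\<forall>\<^sub>F n in sequentially. real (coord_count (k - 1) 0 (n - 2)) \<le> real (gamma_refl k 1 n)"
    using gamma_refl_sandwich(1)[of 1 k] assms by simp
  have *: ?thesis if "poly_asymp (k - 1) C h" "C < ?C" "\<And>n. gamma_refl k p n \<le> h' n" "h = (\<lambda>n. real (h' n))"
    for C h h'
    using poly_asymp_eventually_less[OF that(1) one that(2)] ge
  proof eventually_elim
    case (elim n)
    then show ?case using that(3)[of n] that(4) by simp
  qed
  consider "p = 0" "k = 1" | "p = 0" "k \<ge> 2" | "p = 1" | "p \<ge> 2" using assms by linarith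
  then show ?thesis
  proof cases
    case 1
    show ?thesis
      using ge
    proof eventually_elim
      case (elim n)
      then show ?case using gamma_refl_0_le[of k n] 1 by (simp add: box_count_def)
    qed
  next
    case 2
    \<comment> \<open>With negative slope 0 only \<open>a = k - 1\<close> survives, where
      \<open>0 ^ 0 = 1\<close>.\<close>
    have "(\<Sum>a\<le>k - 1. real ((k - 1) choose a) * (1 ^ a / fact a) * (0 ^ (k - 1 - a) / fact (k - 1 - a))) =
        (\<Sum>a\<in>{k - 1}. real ((k - 1) choose a) * (1 ^ a / fact a) * (0 ^ (k - 1 - a) / fact (k - 1 - a)))"
      by (rule sum.mono_neutral_right) auto
    then have "poly_asymp (k - 1) (1 / fact (k - 1)) (\<lambda>n. real (box_count (k - 1) n 0))"
      using poly_asymp_box_count[of "\<lambda>n. n" 1 0 "\<lambda>_. 0" 0 0 "k - 1"] by simp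
    then show ?thesis
    proof (rule *)
      show "1 / fact (k - 1) < ?C" using 2 by (intro divide_strict_right_mono one_less_power) auto
    qed (use gamma_refl_0_le[of k] 2 in auto)
  next
    case 3
    then show ?thesis by simp
  next
    case 4
    have eq: "2 * p - 2 = 2 * (p - 1)" by simp
    have "real ((2 * (p - 1)) choose (p - 1)) < 2 ^ (2 * (p - 1))"
      unfolding of_nat_less_numeral_power_cancel_iff using 4 by (intro central_binomial_less) simp
    then have "real ((2 * p - 2) choose (p - 1)) / 2 ^ (2 * p - 2) < 1"
      by (simp add: eq)
    then have "real ((2 * p - 2) choose (p - 1)) / 2 ^ (2 * p - 2) * ?C < 1 * ?C"
      by (intro mult_strict_right_mono) simp_all
    then show ?thesis
      using poly_asymp_coord_count'[of p k] gamma_refl_le[of p k] 4 assms by (intro *) auto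
  qed
qed

text \<open>Only finitely many \<open>p\<close> compete, so their thresholds have a common
  bound.\<close>

lemma gamma_eventually_eq:
  assumes "1 \<le> k"
  shows "\<forall>\<^sub>F n in sequentially. gamma k n = gamma_refl k 1 n"
proof -
  have "\<forall>\<^sub>F n in sequentially. \<forall>p\<in>{..k}. gamma_refl k p n \<le> gamma_refl k 1 n"
    by (intro eventually_ball_finite) (use gamma_refl_eventually_le[OF _ assms] in auto)
  then show ?thesis
  proof eventually_elim
    case (elim n)
    have "{gamma_refl k p n | p. p \<le> k} = (\<lambda>p. gamma_refl k p n) ` {..k}" by auto
    then show ?case
      unfolding gamma_eq_Max_gamma_refl using elim assms by (auto intro!: Max_eqI)
  qed
qed

lemma prob_random_subset_card:
  assumes "finite A"
  shows "measure_pmf.prob (pmf_of_set (Pow A)) {B. card B = m} = real (card A choose m) / 2 ^ card A"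
proof -
  have "Pow A \<inter> {B. card B = m} = {B. B \<subseteq> A \<and> card B = m}" by auto
  then show ?thesis
    using assms by (subst measure_pmf_of_set) (auto simp: n_subsets card_Pow)
qed

theorem theorem1p2:
  fixes k p :: nat
  assumes "1 \<le> p" and "p \<le> k"
  shows
    "(\<lambda>n. real (gamma_refl k p n)
        - real ((2 * p - 2) choose (p - 1)) / 2 ^ (2 * p - 2)
          * (2 ^ (k - 1) / fact (k - 1)) * real n ^ (k - 1))
      \<in> O(\<lambda>n. real n powi (int k - 2))
   \<and> (\<lambda>n. real (gamma_refl k p n)
        - measure_pmf.prob (pmf_of_set (Pow {1..2 * p - 2})) {A. card A = p - 1}
          * (2 ^ (k - 1) / fact (k - 1)) * real n ^ (k - 1))
      \<in> O(\<lambda>n. real n powi (int k - 2))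
   \<and> (\<forall>\<^sub>F n in sequentially. gamma k n = gamma_refl k 1 n)
   \<and> (\<lambda>n. real (gamma k n) - 2 ^ (k - 1) / fact (k - 1) * real n ^ (k - 1))
      \<in> O(\<lambda>n. real n powi (int k - 2))"
proof (intro conjI)
  show refl: "(\<lambda>n. real (gamma_refl k p n)
        - real ((2 * p - 2) choose (p - 1)) / 2 ^ (2 * p - 2)
          * (2 ^ (k - 1) / fact (k - 1)) * real n ^ (k - 1))
      \<in> O(\<lambda>n. real n powi (int k - 2))"
    using assms by (rule gamma_refl_bigo)
  then show "(\<lambda>n. real (gamma_refl k p n)
        - measure_pmf.prob (pmf_of_set (Pow {1..2 * p - 2})) {A. card A = p - 1}
          * (2 ^ (k - 1) / fact (k - 1)) * real n ^ (k - 1))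
      \<in> O(\<lambda>n. real n powi (int k - 2))"
    by (simp add: prob_random_subset_card)
  have k: "1 \<le> k" using assms by simp
  show eq: "\<forall>\<^sub>F n in sequentially. gamma k n = gamma_refl k 1 n"
    by (rule gamma_eventually_eq[OF k])
  have "\<forall>\<^sub>F n in sequentially. real (gamma_refl k 1 n) - 2 ^ (k - 1) / fact (k - 1) * real n ^ (k - 1) =
      real (gamma k n) - 2 ^ (k - 1) / fact (k - 1) * real n ^ (k - 1)"
    using eq by eventually_elim simp
  from landau_o.big.in_cong[OF this]
  show "(\<lambda>n. real (gamma k n) - 2 ^ (k - 1) / fact (k - 1) * real n ^ (k - 1))
      \<in> O(\<lambda>n. real n powi (int k - 2))"
    using gamma_refl_bigo[of 1 k] k by simp
qed

end
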